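(* Let $\alpha\in (0,2)$ and $a=\Gamma(\frac{\alpha}{2}+1)/\Gamma(1+\alpha)$. Let $f\in C^2(\mathbb{D})$ be a complex-valued solution of $T_\alpha(f)=0$ in $\mathbb{D}$ satisfying $f(0)=0$, $\lambda_f(0)\geq \beta$ and $\Lambda_f(z)\leq \Lambda$ for each $z\in \mathbb{D}$, where $\Lambda$ and $\beta$ are positive constants. Then $f$ is univalent on the disc $\mathbb{D}_{\rho_0}$, where $\rho_0\in(0,1)$ satisfies the equation $$\beta- \frac{2\Lambda}{2-\alpha}\left((2-\alpha)\frac{\rho_0^2}{1-\rho_0}+\frac{2a}{(1-\rho_0)^3}-2a+(2a-1)\frac{\rho_0^2}{1-\rho_0^2}\right)=0.$$ Moreover, $f(\mathbb{D}_{\rho_0})$ contains a schlicht disc of radius $R_0$ with $$R_0\geq \rho_0\left(\beta-\frac{2\Lambda}{2-\alpha}\left(\frac{2-\alpha}{1-\rho_0}\cdot \frac{\rho_0^2}{3} +\frac{2a}{(1-\rho_0)^3}-2a + \frac{2a-1}{1-\rho_0^2}\cdot\frac{\rho_0^2}{3}\right)\right).$$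
   Context: $\mathbb{D}=\{z\in\mathbb{C}:|z|<1\}$, $\mathbb{D}_\rho=\{z\in\mathbb{C}:|z|<\rho\}$, and $C^2(\mathbb{D})$ is the set of twice continuously differentiable complex-valued functions on $\mathbb{D}$. For $z=x+iy$, $\frac{\partial}{\partial z}=\frac12(\frac{\partial}{\partial x}-i\frac{\partial}{\partial y})$, $\frac{\partial}{\partial\bar z}=\frac12(\frac{\partial}{\partial x}+i\frac{\partial}{\partial y})$, $f_z=\partial f/\partial z$, $f_{\bar z}=\partial f/\partial\bar z$, $\Lambda_f=|f_z|+|f_{\bar z}|$ and $\lambda_f=\big||f_z|-|f_{\bar z}|\big|$. $\Gamma$ is the Gamma function. For $\alpha\in\mathbb{R}$, $T_\alpha$ is the differential operator on $\mathbb{D}$ $$T_\alpha=-\frac{\alpha^2}{4}(1-|z|^2)^{-\alpha-1}+\frac{\alpha}{2}(1-|z|^2)^{-\alpha-1}\left(z \frac{\partial}{\partial z}+\bar{z} \frac{\partial}{\partial \bar{z}}\right)+\frac{1}{4}(1-|z|^2)^{-\alpha} \Delta,\qquad \Delta=4\frac{\partial^2}{\partial z\,\partial\bar z}.$$ Solutions of $T_\alpha(f)=0$ are called $\alpha$-harmonic mappings. "Univalent" means injective. A schlicht disc contained in $f(\Omega)$ is an open disc that is the image under $f$ of a subdomain of $\Omega$ on which $f$ is injective. *)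

theory Defs
  imports "HOL-Analysis.Analysis"
begin

definition partial_x :: "(complex \<Rightarrow> complex) \<Rightarrow> complex \<Rightarrow> complex" where
  "partial_x f z = vector_derivative (\<lambda>t. f (Complex t (Im z))) (at (Re z))"

definition partial_y :: "(complex \<Rightarrow> complex) \<Rightarrow> complex \<Rightarrow> complex" where
  "partial_y f z = vector_derivative (\<lambda>t. f (Complex (Re z) t)) (at (Im z))"

definition wirtinger :: "(complex \<Rightarrow> complex) \<Rightarrow> complex \<Rightarrow> complex" where
  "wirtinger f z = (partial_x f z - \<i> * partial_y f z) / 2"

definition wirtinger_bar :: "(complex \<Rightarrow> complex) \<Rightarrow> complex \<Rightarrow> complex" where
  "wirtinger_bar f z = (partial_x f z + \<i> * partial_y f z) / 2"

(* Derivatives are real-linear maps here, so this is the real C^2 class on an open set S,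
   not holomorphy; on such S the values of f outside S are irrelevant. *)
definition C2_on :: "complex set \<Rightarrow> (complex \<Rightarrow> complex) \<Rightarrow> bool" where
  "C2_on S f \<longleftrightarrow>
     (\<exists>(f' :: complex \<Rightarrow> complex \<Rightarrow>\<^sub>L complex)
       (f'' :: complex \<Rightarrow> complex \<Rightarrow>\<^sub>L (complex \<Rightarrow>\<^sub>L complex)).
        (\<forall>z\<in>S. (f has_derivative blinfun_apply (f' z)) (at z)) \<and>
        (\<forall>z\<in>S. (f' has_derivative blinfun_apply (f'' z)) (at z)) \<and>
        continuous_on S f'')"

definition max_dilation :: "(complex \<Rightarrow> complex) \<Rightarrow> complex \<Rightarrow> real" where
  "max_dilation f z = norm (wirtinger f z) + norm (wirtinger_bar f z)"

definition min_dilation :: "(complex \<Rightarrow> complex) \<Rightarrow> complex \<Rightarrow> real" where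
  "min_dilation f z = \<bar>norm (wirtinger f z) - norm (wirtinger_bar f z)\<bar>"

definition laplacian :: "(complex \<Rightarrow> complex) \<Rightarrow> complex \<Rightarrow> complex" where
  "laplacian f z = 4 * wirtinger (wirtinger_bar f) z"

definition T_op :: "real \<Rightarrow> (complex \<Rightarrow> complex) \<Rightarrow> complex \<Rightarrow> complex" where
  "T_op \<alpha> f z =
     - of_real (\<alpha>\<^sup>2 / 4 * (1 - (norm z)\<^sup>2) powr (- \<alpha> - 1)) * f z
     + of_real (\<alpha> / 2 * (1 - (norm z)\<^sup>2) powr (- \<alpha> - 1))
         * (z * wirtinger f z + cnj z * wirtinger_bar f z)
     + of_real (1 / 4 * (1 - (norm z)\<^sup>2) powr (- \<alpha>)) * laplacian f z"

definition contains_schlicht_disc ::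
    "(complex \<Rightarrow> complex) \<Rightarrow> complex set \<Rightarrow> real \<Rightarrow> bool" where
  "contains_schlicht_disc f \<Omega> R \<longleftrightarrow>
     R > 0 \<and> (\<exists>w U. U \<subseteq> \<Omega> \<and> open U \<and> connected U \<and> inj_on f U \<and> f ` U = ball w R)"

end

theory Submission
  imports Defs
begin

text \<open>
Put \<open>s = \<alpha> / 2\<close>, so \<open>0 < s < 1\<close>. Multiplying \<open>T\<^sub>\<alpha> f = 0\<close> by \<open>(1 - |z|\<^sup>2)\<close> to the power
\<open>\<alpha> + 1\<close> gives the equation \<open>L f = - s\<^sup>2 f + s (z f_z + cnj z f_zbar) + (1 - |z|\<^sup>2) f_zzbar = 0\<close>
(\<open>alpha_op\<close>). Its zero order coefficient is negative, so a maximum principle holds, and it even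
tolerates a small right-hand side (\<open>alpha_op_maximum_principle\<close>): on a disc, a function with
small \<open>L f\<close> and small boundary values is small.

The solutions that are homogeneous under rotation are \<open>F\<^sub>k (|z|\<^sup>2) z ^ k\<close> and their conjugates, where
\<open>F\<^sub>k\<close> is the hypergeometric function with parameters \<open>- s\<close>, \<open>k - s\<close>; \<open>k + 1\<close>. Only Taylor polynomials
of \<open>F\<^sub>k\<close> are needed, because \<open>L\<close> maps such a truncated mode to a single monomial
(\<open>alpha_op_mode\<close>), which is negligible on a smaller disc. On a circle \<open>|z| = \<rho> < 1\<close> the solution \<open>f\<close> is
uniformly close to a trigonometric polynomial; continuing each of its terms by a mode and applying the
maximum principle, \<open>f\<close> is uniformly close on \<open>|z| \<le> \<rho>\<close> to a finite sum of modes
(\<open>approximation_by_modes\<close>). The coefficients are controlled since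
\<open>\<Lambda>_f \<le> \<Lambda>\<close> implies \<open>|f z| \<le> \<Lambda> |z|\<close>, and a Fourier coefficient is at most the supremum.

For \<open>k \<ge> 1\<close> every Taylor coefficient of \<open>F\<^sub>k\<close> after the constant term \<open>1\<close> is at most \<open>0\<close>. This has three
consequences. In the sum \<open>|g_z| + |g_zbar|\<close> for a mode \<open>g\<close> the contributions cancel, leaving at most
\<open>k |z| ^ (k - 1)\<close> (\<open>norm_mode_derivatives_le\<close>). The deviation of the first mode from \<open>z\<close> is of third order,
with an explicit constant (\<open>first_mode_lipschitz\<close>, \<open>norm_first_mode_minus_id_le\<close>). Finally, \<open>F\<^sub>k\<close> is
smallest at \<open>1\<close>, and telescoping sums bound it from below
(\<open>mode_radial_ge_coarse\<close>, \<open>mode_radial_ge_fine\<close>). These bounds are compared with \<open>a\<close>: convexity of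
\<open>ln \<circ> Gamma\<close> gives \<open>a \<ge> 1 - s / 2\<close> (\<open>Gamma_ratio_ge\<close>), whence \<open>1 / F\<^sub>k \<le> a (k + 1) / (2 (1 - s))\<close>
for \<open>k \<ge> 2\<close>, and the sum of \<open>k (k + 1) r ^ (k - 1)\<close> over \<open>k \<ge> 2\<close>, which is \<open>2 / (1 - r) ^ 3 - 2\<close>, produces
the cubic term of the equation for \<open>\<rho>\<^sub>0\<close>.

Letting \<open>\<rho>\<close> tend to \<open>1\<close> (\<open>deviation_from_derivative\<close>), the function \<open>f - Df(0)\<close> has on \<open>|z| \<le> r\<close> a
Lipschitz constant of at most \<open>\<Lambda> * landau_majorant s a 1 r\<close>, and it is bounded at \<open>z\<close> by
\<open>\<Lambda> * landau_majorant s a (1 / 3) |z| * |z|\<close>. In this notation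
\<open>E \<rho> = \<beta> - \<Lambda> * landau_majorant s a 1 \<rho>\<close> and \<open>B \<rho> = \<rho> * (\<beta> - \<Lambda> * landau_majorant s a (1 / 3) \<rho>)\<close>.
As \<open>|Df(0) w| \<ge> \<lambda>_f(0) |w| \<ge> \<beta> |w|\<close>, the linear part dominates on \<open>|z| < \<rho>\<^sub>0\<close>, which gives injectivity, and
\<open>|f| \<ge> B \<rho>\<^sub>0\<close> on \<open>|z| = \<rho>\<^sub>0\<close>, which by connectedness puts the disc of radius \<open>B \<rho>\<^sub>0\<close> about \<open>f 0 = 0\<close> into the image.
\<close>

section \<open>Symmetry of second derivatives\<close>

text \<open>
For fixed \<open>h\<close>, the second difference is the increment over \<open>{0..1}\<close> of
\<open>\<tau> \<mapsto> f (z + \<tau> h v + h w) - f (z + \<tau> h v)\<close>. The derivative of this curve compares \<open>f'\<close> at two points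
that differ by \<open>h w\<close>, so differentiability of \<open>f'\<close> at the single point \<open>z\<close> and the mean value inequality
suffice.
\<close>

lemma second_difference_estimate:
  fixes f :: "'a::real_normed_vector \<Rightarrow> 'b::real_normed_vector"
    and f' :: "'a \<Rightarrow> 'a \<Rightarrow>\<^sub>L 'b" and f'' :: "'a \<Rightarrow>\<^sub>L 'a \<Rightarrow>\<^sub>L 'b"
  assumes S: "open S" "z \<in> S"
    and f: "\<And>x. x \<in> S \<Longrightarrow> (f has_derivative f' x) (at x)"
    and f': "(f' has_derivative f'') (at z)"
    and e: "e > 0"
  shows "\<exists>d>0. \<forall>h. 0 < h \<and> h < d \<longrightarrow>
    norm (f (z + h *\<^sub>R v + h *\<^sub>R w) - f (z + h *\<^sub>R v) - f (z + h *\<^sub>R w) + f z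
      - (h * h) *\<^sub>R f'' w v) \<le> e * (h * h)"
proof -
  define M where "M = 2 * (norm v + norm w + 1) * (norm v + 1)"
  have M: "M > 0" unfolding M_def by (intro mult_pos_pos) (auto intro: add_nonneg_pos)
  obtain d1 where d1: "d1 > 0" "ball z d1 \<subseteq> S"
    using S open_contains_ball by blast
  obtain d2 where d2: "d2 > 0"
    "\<And>y. norm (y - z) < d2 \<Longrightarrow> norm (f' y - f' z - f'' (y - z)) \<le> e / M * norm (y - z)"
    using f' e M unfolding has_derivative_at_alt by (meson divide_pos_pos)
  define d where "d = min d1 d2 / (norm v + norm w + 1)"
  have K: "norm v + norm w + 1 > 0" by (auto intro: add_nonneg_pos)
  have d: "d > 0" using d1 d2 K by (simp add: d_def)
  show ?thesis
  proof (intro exI[of _ d] conjI d allI impI)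
    fix h assume h: "0 < h \<and> h < d"
    have hd: "h * (norm v + norm w + 1) < min d1 d2"
      using h K by (simp add: d_def field_simps)
    define \<phi> where "\<phi> \<tau> = f (z + (\<tau> * h) *\<^sub>R v + h *\<^sub>R w) - f (z + (\<tau> * h) *\<^sub>R v) - (\<tau> * (h * h)) *\<^sub>R f'' w v" for \<tau>
    define \<phi>' where "\<phi>' \<tau> = h *\<^sub>R (f' (z + (\<tau> * h) *\<^sub>R v + h *\<^sub>R w) v - f' (z + (\<tau> * h) *\<^sub>R v) v - h *\<^sub>R f'' w v)" for \<tau>
    have small: "norm ((\<tau> * h) *\<^sub>R v + c *\<^sub>R w) \<le> h * (norm v + norm w + 1)"
      if "\<tau> \<in> {0..1}" "c \<in> {0,h}" for \<tau> c
    proof -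
      have "norm ((\<tau> * h) *\<^sub>R v + c *\<^sub>R w) \<le> \<tau> * h * norm v + c * norm w"
        using norm_triangle_ineq[of "(\<tau> * h) *\<^sub>R v" "c *\<^sub>R w"] that h by auto
      also have "\<dots> \<le> 1 * h * norm v + h * norm w"
        using that h by (intro add_mono mult_right_mono) auto
      finally show ?thesis using h by (simp add: algebra_simps)
    qed
    have inS: "z + (\<tau> * h) *\<^sub>R v + c *\<^sub>R w \<in> S" if "\<tau> \<in> {0..1}" "c \<in> {0,h}" for \<tau> c
    proof -
      have "dist z (z + (\<tau> * h) *\<^sub>R v + c *\<^sub>R w) < d1"
        using small[OF that] hd dist_add_cancel[of z 0 "(\<tau> * h) *\<^sub>R v + c *\<^sub>R w"]
        by (simp add: add.assoc)
      thus ?thesis using d1 by auto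
    qed
    have der: "(\<phi> has_derivative (\<lambda>t. t *\<^sub>R \<phi>' \<tau>)) (at \<tau> within {0..1})" if t: "\<tau> \<in> {0..1}" for \<tau>
    proof -
      have aff: "((\<lambda>\<tau>. z + (\<tau> * h) *\<^sub>R v + c *\<^sub>R w) has_derivative (\<lambda>t. (t * h) *\<^sub>R v)) (at \<tau> within {0..1})" for c
        by (auto intro!: derivative_eq_intros)
      have a: "((\<lambda>\<tau>. f (z + (\<tau> * h) *\<^sub>R v + c *\<^sub>R w)) has_derivative
          (\<lambda>t. f' (z + (\<tau> * h) *\<^sub>R v + c *\<^sub>R w) ((t * h) *\<^sub>R v))) (at \<tau> within {0..1})"
        if "c \<in> {0,h}" for c
        using has_derivative_compose[OF aff f[OF inS[OF t that]]] by simp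
      show ?thesis
        unfolding \<phi>_def \<phi>'_def using a[of h] a[of 0]
        by (auto intro!: derivative_eq_intros simp: blinfun.scaleR_right algebra_simps)
    qed
    have bound: "norm (\<phi>' \<tau>) \<le> e * (h * h)" if t: "\<tau> \<in> {0..1}" for \<tau>
    proof -
      define y1 where "y1 = z + (\<tau> * h) *\<^sub>R v + h *\<^sub>R w"
      define y2 where "y2 = z + (\<tau> * h) *\<^sub>R v + 0 *\<^sub>R w"
      have n1: "norm (y1 - z) \<le> h * (norm v + norm w + 1)"
        using small[OF t, of h] by (simp add: y1_def add.assoc)
      have n2: "norm (y2 - z) \<le> h * (norm v + norm w + 1)"
        using small[OF t, of 0] by (simp add: y2_def add.assoc)
      define A1 where "A1 = f' y1 - f' z - f'' (y1 - z)"
      define A2 where "A2 = f' y2 - f' z - f'' (y2 - z)"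
      have eM: "e / M > 0" using e M by simp
      have A1: "norm A1 \<le> e / M * (h * (norm v + norm w + 1))"
        using d2(2)[of y1] n1 hd eM unfolding A1_def
        by (smt (verit) mult_left_mono min.cobounded2)
      have A2: "norm A2 \<le> e / M * (h * (norm v + norm w + 1))"
        using d2(2)[of y2] n2 hd eM unfolding A2_def
        by (smt (verit) mult_left_mono min.cobounded2)
      have "\<phi>' \<tau> = h *\<^sub>R ((A1 - A2) v)"
      proof -
        have "f'' (y1 - z) v - f'' (y2 - z) v = h *\<^sub>R f'' w v"
          by (simp add: y1_def y2_def blinfun.bilinear_simps)
        moreover have "\<phi>' \<tau> = h *\<^sub>R (f' y1 v - f' y2 v - h *\<^sub>R f'' w v)"
          by (simp add: \<phi>'_def y1_def y2_def)
        ultimately show ?thesis unfolding A1_def A2_def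
          by (simp add: blinfun.bilinear_simps algebra_simps)
      qed
      hence "norm (\<phi>' \<tau>) = h * norm ((A1 - A2) v)" using h by simp
      also have "\<dots> \<le> h * ((norm A1 + norm A2) * norm v)"
        using h by (intro mult_left_mono order_trans[OF norm_blinfun] mult_right_mono norm_triangle_ineq4) auto
      also have "\<dots> \<le> h * ((2 * (e / M * (h * (norm v + norm w + 1)))) * (norm v + 1))"
      proof (intro mult_left_mono mult_mono)
        show "norm A1 + norm A2 \<le> 2 * (e / M * (h * (norm v + norm w + 1)))"
          using add_mono[OF A1 A2] by (simp only: mult_2)
        have "0 \<le> norm A1" by simp
        also note A1
        finally show "0 \<le> 2 * (e / M * (h * (norm v + norm w + 1)))" by simp
      qed (use h in auto)
      also have "\<dots> = e / M * M * (h * h)" by (simp add: M_def algebra_simps)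
      also have "\<dots> = e * (h * h)" using M by simp
      finally show ?thesis .
    qed
    have "norm (\<phi> 1 - \<phi> 0) \<le> e * (h * h) * norm (1 - 0 :: real)"
    proof (rule differentiable_bound[where S="{0..1::real}" and f'="\<lambda>\<tau> t. t *\<^sub>R \<phi>' \<tau>"])
      fix \<tau> :: real assume "\<tau> \<in> {0..1}"
      thus "onorm (\<lambda>t. t *\<^sub>R \<phi>' \<tau>) \<le> e * (h * h)"
        using mult_left_mono[OF bound abs_ge_zero] by (intro onorm_le) (simp add: mult.commute)
    qed (use der in auto)
    thus "norm (f (z + h *\<^sub>R v + h *\<^sub>R w) - f (z + h *\<^sub>R v) - f (z + h *\<^sub>R w) + f z
      - (h * h) *\<^sub>R f'' w v) \<le> e * (h * h)"
      by (simp add: \<phi>_def algebra_simps)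
  qed
qed

text \<open>
The second difference does not change when \<open>v\<close> and \<open>w\<close> are exchanged, and divided by \<open>h\<^sup>2\<close> it converges to
both sides.
\<close>

lemma second_derivative_symmetric:
  fixes f :: "'a::real_normed_vector \<Rightarrow> 'b::real_normed_vector"
    and f' :: "'a \<Rightarrow> 'a \<Rightarrow>\<^sub>L 'b" and f'' :: "'a \<Rightarrow>\<^sub>L 'a \<Rightarrow>\<^sub>L 'b"
  assumes S: "open S" "z \<in> S"
    and f: "\<And>x. x \<in> S \<Longrightarrow> (f has_derivative f' x) (at x)"
    and f': "(f' has_derivative f'') (at z)"
  shows "f'' v w = f'' w v"
proof -
  have "norm (f'' v w - f'' w v) \<le> 0 + e" if e: "e > 0" for e
  proof -
    have e2: "e / 2 > 0" using e by simp
    obtain d1 d2 where d: "d1 > 0" "d2 > 0" and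
      1: "\<And>h. 0 < h \<and> h < d1 \<longrightarrow>
    norm (f (z + h *\<^sub>R v + h *\<^sub>R w) - f (z + h *\<^sub>R v) - f (z + h *\<^sub>R w) + f z
      - (h * h) *\<^sub>R f'' w v) \<le> e / 2 * (h * h)" and
      2: "\<And>h. 0 < h \<and> h < d2 \<longrightarrow>
    norm (f (z + h *\<^sub>R w + h *\<^sub>R v) - f (z + h *\<^sub>R w) - f (z + h *\<^sub>R v) + f z
      - (h * h) *\<^sub>R f'' v w) \<le> e / 2 * (h * h)"
      using second_difference_estimate[OF S f f' e2, of v w]
        second_difference_estimate[OF S f f' e2, of w v] by metis
    define h where "h = min d1 d2 / 2"
    have h: "0 < h" "h < d1" "h < d2" using d by (auto simp: h_def)
    let ?D = "f (z + h *\<^sub>R v + h *\<^sub>R w) - f (z + h *\<^sub>R v) - f (z + h *\<^sub>R w) + f z"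
    have sw: "f (z + h *\<^sub>R w + h *\<^sub>R v) - f (z + h *\<^sub>R w) - f (z + h *\<^sub>R v) + f z = ?D"
      by (simp add: add.assoc add.commute[of "h *\<^sub>R w"])
    have b1: "norm (?D - (h * h) *\<^sub>R f'' w v) \<le> e / 2 * (h * h)"
      using 1[of h] h by blast
    have b2: "norm (?D - (h * h) *\<^sub>R f'' v w) \<le> e / 2 * (h * h)"
      using 2[of h] h unfolding sw by blast
    have "norm ((?D - (h * h) *\<^sub>R f'' w v) - (?D - (h * h) *\<^sub>R f'' v w)) \<le> e / 2 * (h * h) + e / 2 * (h * h)"
      using norm_triangle_ineq4 b1 b2 by (rule order_trans[OF _ add_mono])
    hence "norm ((h * h) *\<^sub>R (f'' v w - f'' w v)) \<le> e * (h * h)"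
      by (simp add: algebra_simps)
    thus ?thesis using h by simp
  qed
  hence "norm (f'' v w - f'' w v) \<le> 0" by (rule field_le_epsilon)
  thus ?thesis by simp
qed

section \<open>Wirtinger calculus\<close>

text \<open>
A second-order jet in complex notation: \<open>p = f_z\<close>, \<open>q = f_zbar\<close> and \<open>l = f_zzbar\<close>. One function \<open>l\<close> occurs as
the \<open>zbar\<close>-derivative of \<open>p\<close> and as the \<open>z\<close>-derivative of \<open>q\<close>, which encodes the symmetry of the second
derivative. The pure second derivatives are quantified existentially because the equation involves only the mixed
one.
\<close>

definition wirtinger_jet ::
    "complex set \<Rightarrow> (complex \<Rightarrow> complex) \<Rightarrow> (complex \<Rightarrow> complex) \<Rightarrow> (complex \<Rightarrow> complex) \<Rightarrow> (complex \<Rightarrow> complex) \<Rightarrow> bool" where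
  "wirtinger_jet S f p q l \<longleftrightarrow>
     (\<forall>z\<in>S. (f has_derivative (\<lambda>w. p z * w + q z * cnj w)) (at z) \<and>
       (\<exists>a. (p has_derivative (\<lambda>w. a * w + l z * cnj w)) (at z)) \<and>
       (\<exists>b. (q has_derivative (\<lambda>w. l z * w + b * cnj w)) (at z)))"

lemma wirtinger_jet_add:
  assumes "wirtinger_jet S f p q l" "wirtinger_jet S g p' q' l'"
  shows "wirtinger_jet S (\<lambda>z. f z + g z) (\<lambda>z. p z + p' z) (\<lambda>z. q z + q' z) (\<lambda>z. l z + l' z)"
  unfolding wirtinger_jet_def
proof (intro ballI conjI)
  fix z assume z: "z \<in> S"
  note A = bspec[OF assms(1)[unfolded wirtinger_jet_def] z] bspec[OF assms(2)[unfolded wirtinger_jet_def] z]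
  from A show "((\<lambda>z. f z + g z) has_derivative (\<lambda>w. (p z + p' z) * w + (q z + q' z) * cnj w)) (at z)"
    by (auto intro!: derivative_eq_intros simp: algebra_simps)
  from A obtain a b a' b' where
    "(p has_derivative (\<lambda>w. a * w + l z * cnj w)) (at z)" "(p' has_derivative (\<lambda>w. a' * w + l' z * cnj w)) (at z)"
    "(q has_derivative (\<lambda>w. l z * w + b * cnj w)) (at z)" "(q' has_derivative (\<lambda>w. l' z * w + b' * cnj w)) (at z)"
    by blast
  thus "\<exists>a. ((\<lambda>z. p z + p' z) has_derivative (\<lambda>w. a * w + (l z + l' z) * cnj w)) (at z)"
    "\<exists>b. ((\<lambda>z. q z + q' z) has_derivative (\<lambda>w. (l z + l' z) * w + b * cnj w)) (at z)"
    by - (rule exI[of _ "a + a'"] exI[of _ "b + b'"], auto intro!: derivative_eq_intros simp: algebra_simps)+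
qed

lemma wirtinger_jet_cmult:
  assumes "wirtinger_jet S f p q l"
  shows "wirtinger_jet S (\<lambda>z. c * f z) (\<lambda>z. c * p z) (\<lambda>z. c * q z) (\<lambda>z. c * l z)"
  unfolding wirtinger_jet_def
proof (intro ballI conjI)
  fix z assume z: "z \<in> S"
  note A = bspec[OF assms(1)[unfolded wirtinger_jet_def] z]
  from A show "((\<lambda>z. c * f z) has_derivative (\<lambda>w. (c * p z) * w + (c * q z) * cnj w)) (at z)"
    by (auto intro!: derivative_eq_intros simp: algebra_simps)
  from A obtain a b where
    "(p has_derivative (\<lambda>w. a * w + l z * cnj w)) (at z)"
    "(q has_derivative (\<lambda>w. l z * w + b * cnj w)) (at z)"
    by blast
  thus "\<exists>a. ((\<lambda>z. c * p z) has_derivative (\<lambda>w. a * w + (c * l z) * cnj w)) (at z)"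
    "\<exists>b. ((\<lambda>z. c * q z) has_derivative (\<lambda>w. (c * l z) * w + b * cnj w)) (at z)"
    by - (rule exI[of _ "c * a"] exI[of _ "c * b"], auto intro!: derivative_eq_intros simp: algebra_simps)+
qed

lemma wirtinger_jet_zero: "wirtinger_jet S (\<lambda>z. 0) (\<lambda>z. 0) (\<lambda>z. 0) (\<lambda>z. 0)"
  unfolding wirtinger_jet_def using has_derivative_const by (auto intro!: exI[of _ 0] simp: lambda_zero[symmetric])

lemma wirtinger_jet_sum:
  assumes "\<And>i. i \<in> I \<Longrightarrow> wirtinger_jet S (f i) (p i) (q i) (l i)"
  shows "wirtinger_jet S (\<lambda>z. \<Sum>i\<in>I. f i z) (\<lambda>z. \<Sum>i\<in>I. p i z) (\<lambda>z. \<Sum>i\<in>I. q i z) (\<lambda>z. \<Sum>i\<in>I. l i z)"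
  using assms
  by (induction I rule: infinite_finite_induct) (simp_all add: wirtinger_jet_zero wirtinger_jet_add)

lemma monomial_has_derivative:
  "((\<lambda>z. z ^ m * cnj z ^ n) has_derivative
    (\<lambda>w. (of_nat m * z ^ (m - 1) * cnj z ^ n) * w + (of_nat n * z ^ m * cnj z ^ (n - 1)) * cnj w)) (at z)"
proof -
  have "((\<lambda>z. z ^ m) has_derivative (\<lambda>w. of_nat m * z ^ (m - 1) * w)) (at z)"
    by (auto intro!: derivative_eq_intros simp: ac_simps)
  moreover have "((\<lambda>z. cnj z ^ n) has_derivative (\<lambda>w. of_nat n * cnj z ^ (n - 1) * cnj w)) (at z)"
    by (auto intro!: derivative_eq_intros simp: ac_simps)
  ultimately show ?thesis
    by (auto intro!: derivative_eq_intros simp: algebra_simps)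
qed

lemma wirtinger_jet_monomial:
  "wirtinger_jet S (\<lambda>z. z ^ m * cnj z ^ n) (\<lambda>z. of_nat m * z ^ (m - 1) * cnj z ^ n)
     (\<lambda>z. of_nat n * z ^ m * cnj z ^ (n - 1)) (\<lambda>z. of_nat (m * n) * z ^ (m - 1) * cnj z ^ (n - 1))"
  unfolding wirtinger_jet_def
proof (intro ballI conjI)
  fix z
  show "((\<lambda>z. z ^ m * cnj z ^ n) has_derivative
    (\<lambda>w. (of_nat m * z ^ (m - 1) * cnj z ^ n) * w + (of_nat n * z ^ m * cnj z ^ (n - 1)) * cnj w)) (at z)"
    by (rule monomial_has_derivative)
  have "((\<lambda>z. of_nat m * (z ^ (m-1) * cnj z ^ n)) has_derivative
     (\<lambda>w. of_nat m * ((of_nat (m-1) * z ^ (m - 1 - 1) * cnj z ^ n) * w + (of_nat n * z ^ (m-1) * cnj z ^ (n - 1)) * cnj w))) (at z)"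
    by (rule has_derivative_mult_right[OF monomial_has_derivative])
  thus "\<exists>a. ((\<lambda>z. of_nat m * z ^ (m - 1) * cnj z ^ n) has_derivative
     (\<lambda>w. a * w + of_nat (m * n) * z ^ (m - 1) * cnj z ^ (n - 1) * cnj w)) (at z)"
    by (intro exI[of _ "of_nat m * (of_nat (m-1) * z ^ (m - 1 - 1) * cnj z ^ n)"])
      (simp add: algebra_simps)
  have "((\<lambda>z. of_nat n * (z ^ m * cnj z ^ (n-1))) has_derivative
     (\<lambda>w. of_nat n * ((of_nat m * z ^ (m - 1) * cnj z ^ (n-1)) * w + (of_nat (n-1) * z ^ m * cnj z ^ (n - 1 - 1)) * cnj w))) (at z)"
    by (rule has_derivative_mult_right[OF monomial_has_derivative])
  thus "\<exists>b. ((\<lambda>z. of_nat n * z ^ m * cnj z ^ (n - 1)) has_derivative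
     (\<lambda>w. of_nat (m * n) * z ^ (m - 1) * cnj z ^ (n - 1) * w + b * cnj w)) (at z)"
    by (intro exI[of _ "of_nat n * (of_nat (n-1) * z ^ m * cnj z ^ (n - 1 - 1))"])
      (simp add: algebra_simps)
qed

lemma wirtinger_jet_cnj:
  assumes "wirtinger_jet S f p q l"
  shows "wirtinger_jet S (\<lambda>z. cnj (f z)) (\<lambda>z. cnj (q z)) (\<lambda>z. cnj (p z)) (\<lambda>z. cnj (l z))"
  unfolding wirtinger_jet_def
proof (intro ballI conjI)
  fix z assume z: "z \<in> S"
  note A = bspec[OF assms(1)[unfolded wirtinger_jet_def] z]
  have "((\<lambda>z. cnj (f z)) has_derivative (\<lambda>w. cnj (p z * w + q z * cnj w))) (at z)"
    using A by (intro has_derivative_cnj) auto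
  thus "((\<lambda>z. cnj (f z)) has_derivative (\<lambda>w. cnj (q z) * w + cnj (p z) * cnj w)) (at z)"
    by (simp add: add.commute)
  from A obtain a b where
    "(p has_derivative (\<lambda>w. a * w + l z * cnj w)) (at z)"
    "(q has_derivative (\<lambda>w. l z * w + b * cnj w)) (at z)"
    by blast
  from this[THEN has_derivative_cnj]
  show "\<exists>a. ((\<lambda>z. cnj (q z)) has_derivative (\<lambda>w. a * w + cnj (l z) * cnj w)) (at z)"
    "\<exists>b. ((\<lambda>z. cnj (p z)) has_derivative (\<lambda>w. cnj (l z) * w + b * cnj w)) (at z)"
    by - (rule exI[of _ "cnj b"] exI[of _ "cnj a"], simp add: add.commute)+
qed

lemma wirtinger_jet_subset:
  "wirtinger_jet S f p q l \<Longrightarrow> T \<subseteq> S \<Longrightarrow> wirtinger_jet T f p q l"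
  unfolding wirtinger_jet_def by blast

lemma wirtinger_jet_imp_continuous_on:
  assumes "wirtinger_jet S f p q l"
  shows "continuous_on S f"
proof (rule continuous_at_imp_continuous_on, rule ballI)
  fix z assume "z \<in> S"
  hence "(f has_derivative (\<lambda>w. p z * w + q z * cnj w)) (at z)"
    using assms unfolding wirtinger_jet_def by blast
  thus "isCont f z" by (rule has_derivative_continuous)
qed

text \<open>
The real-linear map \<open>w \<mapsto> p w + q cnj w\<close> has operator norm at most \<open>|p| + |q|\<close>, so this is the mean value
inequality in terms of \<open>\<Lambda>_f\<close>.
\<close>

lemma wirtinger_jet_lipschitz:
  assumes jet: "wirtinger_jet S f p q l" and S: "convex S"
    and B: "\<And>z. z \<in> S \<Longrightarrow> norm (p z) + norm (q z) \<le> B"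
    and xy: "x \<in> S" "y \<in> S"
  shows "norm (f x - f y) \<le> B * norm (x - y)"
proof (rule differentiable_bound[where S=S and f'="\<lambda>z w. p z * w + q z * cnj w"])
  fix z assume z: "z \<in> S"
  show "(f has_derivative (\<lambda>w. p z * w + q z * cnj w)) (at z within S)"
    using jet z unfolding wirtinger_jet_def by (meson has_derivative_at_withinI)
  show "onorm (\<lambda>w. p z * w + q z * cnj w) \<le> B"
  proof (rule onorm_le)
    fix w
    have "norm (p z * w + q z * cnj w) \<le> (norm (p z) + norm (q z)) * norm w"
      using norm_triangle_ineq[of "p z * w" "q z * cnj w"] by (simp add: norm_mult algebra_simps)
    also have "\<dots> \<le> B * norm w" using B[OF z] by (intro mult_right_mono) auto
    finally show "norm (p z * w + q z * cnj w) \<le> B * norm w" .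
  qed
qed (use xy S in auto)

text \<open>
These identities link the partial derivatives, which are limits along coordinate lines, to total
derivatives.
\<close>

lemma partials_of_has_derivative:
  assumes "(g has_derivative G) (at z)"
  shows "partial_x g z = G 1" "partial_y g z = G \<i>"
proof -
  interpret G: bounded_linear G using assms by (rule has_derivative_bounded_linear)
  have "(\<lambda>t. Complex t (Im z)) = (\<lambda>t. of_real t + \<i> * of_real (Im z))"
    by (simp add: fun_eq_iff complex_eq_iff)
  hence "((\<lambda>t. Complex t (Im z)) has_derivative (\<lambda>h. h *\<^sub>R 1)) (at (Re z))"
    by (auto intro!: derivative_eq_intros simp: scaleR_conv_of_real)
  from has_derivative_compose[OF this, of g G] assms
  have "((\<lambda>t. g (Complex t (Im z))) has_derivative (\<lambda>h. h *\<^sub>R G 1)) (at (Re z))"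
    by (simp add: G.scaleR)
  thus "partial_x g z = G 1"
    unfolding partial_x_def by (intro vector_derivative_at) (simp add: has_vector_derivative_def)
  have "(\<lambda>t. Complex (Re z) t) = (\<lambda>t. of_real (Re z) + \<i> * of_real t)"
    by (simp add: fun_eq_iff complex_eq_iff)
  hence "((\<lambda>t. Complex (Re z) t) has_derivative (\<lambda>h. h *\<^sub>R \<i>)) (at (Im z))"
    by (auto intro!: derivative_eq_intros simp: scaleR_conv_of_real)
  from has_derivative_compose[OF this, of g G] assms
  have "((\<lambda>t. g (Complex (Re z) t)) has_derivative (\<lambda>h. h *\<^sub>R G \<i>)) (at (Im z))"
    by (simp add: G.scaleR)
  thus "partial_y g z = G \<i>"
    unfolding partial_y_def by (intro vector_derivative_at) (simp add: has_vector_derivative_def)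
qed

lemma has_derivative_wirtinger:
  assumes "(g has_derivative G) (at z)"
  shows "(g has_derivative (\<lambda>w. wirtinger g z * w + wirtinger_bar g z * cnj w)) (at z)"
proof -
  interpret G: bounded_linear G using assms by (rule has_derivative_bounded_linear)
  have "G w = wirtinger g z * w + wirtinger_bar g z * cnj w" for w
  proof -
    have "G w = G (Re w *\<^sub>R 1 + Im w *\<^sub>R \<i>)"
      by (rule arg_cong[of _ _ G]) (simp add: complex_eq_iff)
    also have "\<dots> = of_real (Re w) * G 1 + of_real (Im w) * G \<i>"
      unfolding G.add G.scaleR by (simp add: scaleR_conv_of_real)
    also have "\<dots> = wirtinger g z * w + wirtinger_bar g z * cnj w"
      unfolding wirtinger_def wirtinger_bar_def partials_of_has_derivative[OF assms]
      by (simp add: complex_eq_iff field_simps)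
    finally show ?thesis .
  qed
  hence "G = (\<lambda>w. wirtinger g z * w + wirtinger_bar g z * cnj w)" by (simp add: fun_eq_iff)
  thus ?thesis using assms by simp
qed

text \<open>
The two mixed derivatives \<open>wirtinger_bar (wirtinger f)\<close> and \<open>wirtinger (wirtinger_bar f)\<close> agree by the
symmetry of the second derivative of \<open>f\<close>.
\<close>

lemma wirtinger_jet_of_C2:
  assumes S: "open S" and C2: "C2_on S f"
  shows "wirtinger_jet S f (wirtinger f) (wirtinger_bar f) (\<lambda>z. laplacian f z / 4)"
proof -
  obtain f' :: "complex \<Rightarrow> complex \<Rightarrow>\<^sub>L complex" and f'' :: "complex \<Rightarrow> complex \<Rightarrow>\<^sub>L (complex \<Rightarrow>\<^sub>L complex)"
    where f': "\<And>z. z \<in> S \<Longrightarrow> (f has_derivative f' z) (at z)"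
      and f'': "\<And>z. z \<in> S \<Longrightarrow> (f' has_derivative f'' z) (at z)"
    using C2 unfolding C2_on_def by blast
  show ?thesis
    unfolding wirtinger_jet_def
  proof (intro ballI conjI)
    fix z assume z: "z \<in> S"
    show "(f has_derivative (\<lambda>w. wirtinger f z * w + wirtinger_bar f z * cnj w)) (at z)"
      by (rule has_derivative_wirtinger[OF f'[OF z]])
    define P Q where "P = (\<lambda>w. (f'' z w 1 - \<i> * f'' z w \<i>) / 2)"
      and "Q = (\<lambda>w. (f'' z w 1 + \<i> * f'' z w \<i>) / 2)"
    have app: "((\<lambda>x. f' x v) has_derivative (\<lambda>w. f'' z w v)) (at z)" for v
      using f''[OF z] by (rule blinfun.FDERIV[OF _ has_derivative_const, THEN has_derivative_eq_rhs])
        (simp add: blinfun.zero_right)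
    have "((\<lambda>x. (f' x 1 - \<i> * f' x \<i>) * (1 / 2)) has_derivative
        (\<lambda>w. (f'' z w 1 - \<i> * f'' z w \<i>) * (1 / 2))) (at z)"
      by (intro has_derivative_mult_left has_derivative_diff has_derivative_mult_right app)
    hence "((\<lambda>x. (f' x 1 - \<i> * f' x \<i>) / 2) has_derivative P) (at z)"
      by (simp add: P_def)
    hence P: "(wirtinger f has_derivative P) (at z)"
      by (rule has_derivative_transform_within_open[OF _ S z])
        (simp add: wirtinger_def partials_of_has_derivative[OF f'])
    have "((\<lambda>x. (f' x 1 + \<i> * f' x \<i>) * (1 / 2)) has_derivative
        (\<lambda>w. (f'' z w 1 + \<i> * f'' z w \<i>) * (1 / 2))) (at z)"
      by (intro has_derivative_mult_left has_derivative_add has_derivative_mult_right app)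
    hence "((\<lambda>x. (f' x 1 + \<i> * f' x \<i>) / 2) has_derivative Q) (at z)"
      by (simp add: Q_def)
    hence Q: "(wirtinger_bar f has_derivative Q) (at z)"
      by (rule has_derivative_transform_within_open[OF _ S z])
        (simp add: wirtinger_bar_def partials_of_has_derivative[OF f'])
    have sym: "f'' z 1 \<i> = f'' z \<i> 1"
      by (rule second_derivative_symmetric[OF S z f' f''[OF z]])
    have l1: "wirtinger (wirtinger_bar f) z = laplacian f z / 4"
      by (simp add: laplacian_def)
    have "wirtinger_bar (wirtinger f) z = wirtinger (wirtinger_bar f) z"
      unfolding wirtinger_def[of "wirtinger_bar f"] wirtinger_bar_def[of "wirtinger f"]
        partials_of_has_derivative[OF P] partials_of_has_derivative[OF Q] P_def Q_def
      using sym by (simp add: field_simps)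
    hence l2: "wirtinger_bar (wirtinger f) z = laplacian f z / 4" using l1 by simp
    show "\<exists>a. (wirtinger f has_derivative (\<lambda>w. a * w + laplacian f z / 4 * cnj w)) (at z)"
      using has_derivative_wirtinger[OF P] l2 by auto
    show "\<exists>b. (wirtinger_bar f has_derivative (\<lambda>w. laplacian f z / 4 * w + b * cnj w)) (at z)"
      using has_derivative_wirtinger[OF Q] l1 by auto
  qed
qed

section \<open>The operator and its maximum principle\<close>

text \<open>
The operator \<open>T_op (2 * s)\<close> without the weight \<open>(1 - |z|\<^sup>2)\<close> to the power \<open>- 2 * s - 1\<close>. The derivatives
are arguments so that linearity and conjugation hold as plain identities.
\<close>

definition alpha_op ::
    "real \<Rightarrow> (complex \<Rightarrow> complex) \<Rightarrow> (complex \<Rightarrow> complex) \<Rightarrow> (complex \<Rightarrow> complex) \<Rightarrow> (complex \<Rightarrow> complex) \<Rightarrow> complex \<Rightarrow> complex" where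
  "alpha_op s f p q l z = - of_real (s\<^sup>2) * f z + of_real s * (z * p z + cnj z * q z)
     + of_real (1 - (norm z)\<^sup>2) * l z"

lemma alpha_op_add:
  "alpha_op s (\<lambda>z. f z + g z) (\<lambda>z. p z + p' z) (\<lambda>z. q z + q' z) (\<lambda>z. l z + l' z) z =
   alpha_op s f p q l z + alpha_op s g p' q' l' z"
  by (simp add: alpha_op_def algebra_simps)

lemma alpha_op_cmult:
  "alpha_op s (\<lambda>z. c * f z) (\<lambda>z. c * p z) (\<lambda>z. c * q z) (\<lambda>z. c * l z) z = c * alpha_op s f p q l z"
  by (simp add: alpha_op_def algebra_simps)

lemma alpha_op_sum:
  "alpha_op s (\<lambda>z. \<Sum>i\<in>I. f i z) (\<lambda>z. \<Sum>i\<in>I. p i z) (\<lambda>z. \<Sum>i\<in>I. q i z) (\<lambda>z. \<Sum>i\<in>I. l i z) z =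
   (\<Sum>i\<in>I. alpha_op s (f i) (p i) (q i) (l i) z)"
  by (induction I rule: infinite_finite_induct) (simp_all add: alpha_op_add, simp_all add: alpha_op_def)

lemma alpha_op_cnj:
  "alpha_op s (\<lambda>z. cnj (f z)) (\<lambda>z. cnj (q z)) (\<lambda>z. cnj (p z)) (\<lambda>z. cnj (l z)) z = cnj (alpha_op s f p q l z)"
  by (simp add: alpha_op_def algebra_simps)

lemma alpha_op_eq_zero_of_T_op:
  assumes T: "T_op \<alpha> f z = 0" and z: "norm z < 1"
  shows "alpha_op (\<alpha> / 2) f (wirtinger f) (wirtinger_bar f) (\<lambda>z. laplacian f z / 4) z = 0"
proof -
  define u where "u = 1 - (norm z)\<^sup>2"
  have u: "u > 0" using z by (simp add: u_def abs_square_less_1)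
  have pw: "u powr (- \<alpha>) = u * u powr (- \<alpha> - 1)"
    using u by (simp add: powr_mult_base)
  have "T_op \<alpha> f z = of_real (u powr (- \<alpha> - 1)) *
    alpha_op (\<alpha> / 2) f (wirtinger f) (wirtinger_bar f) (\<lambda>z. laplacian f z / 4) z"
    unfolding T_op_def alpha_op_def u_def[symmetric] pw
    by (simp add: algebra_simps power2_eq_square)
  thus ?thesis using T u by simp
qed

lemma second_derivative_test_max:
  fixes \<phi> \<phi>' :: "real \<Rightarrow> real"
  assumes d: "d > 0"
    and \<phi>: "\<And>t. \<bar>t\<bar> < d \<Longrightarrow> (\<phi> has_real_derivative \<phi>' t) (at t)"
    and D: "(\<phi>' has_real_derivative D) (at 0)"
    and max: "\<And>t. \<bar>t\<bar> < d \<Longrightarrow> \<phi> t \<le> \<phi> 0"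
  shows "\<phi>' 0 = 0" "D \<le> 0"
proof -
  show 0: "\<phi>' 0 = 0"
    using DERIV_local_max[OF \<phi>[of 0] d] d max by auto
  show "D \<le> 0"
  proof (rule ccontr)
    assume "\<not> D \<le> 0"
    then obtain e where e: "e > 0" "\<And>h. h > 0 \<Longrightarrow> h < e \<Longrightarrow> \<phi>' 0 < \<phi>' (0 + h)"
      using DERIV_pos_inc_right[OF D] by (meson linorder_not_le)
    define t where "t = min d e / 2"
    have t: "0 < t" "t < d" "t < e" using d e by (auto simp: t_def)
    obtain x where x: "0 < x" "x < t" "\<phi> t - \<phi> 0 = (t - 0) * \<phi>' x"
      using MVT2[of 0 t \<phi> \<phi>'] t \<phi> by (auto simp: abs_if)
    have "\<phi>' x > 0" using e(2)[of x] x t 0 by auto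
    hence "\<phi> t > \<phi> 0" using x t by (simp add: algebra_simps)
    thus False using max[of t] t by auto
  qed
qed

text \<open>
At an interior maximum of the real part of \<open>e f\<close> the first derivative vanishes in all directions. Adding the
second derivative tests for the directions \<open>1\<close> and \<open>\<i>\<close> eliminates the pure second derivatives and leaves
the Laplacian.
\<close>

lemma wirtinger_jet_interior_max:
  assumes jet: "wirtinger_jet S f p q l" and S: "open S" "z \<in> S"
    and max: "\<And>x. x \<in> S \<Longrightarrow> Re (e * f x) \<le> Re (e * f z)"
  shows "Re (e * (p z * w + q z * cnj w)) = 0" "Re (e * l z) \<le> 0"
proof -
  obtain r where r: "r > 0" "ball z r \<subseteq> S" using S open_contains_ball by blast
  obtain a b where ab: "(p has_derivative (\<lambda>w. a * w + l z * cnj w)) (at z)"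
    "(q has_derivative (\<lambda>w. l z * w + b * cnj w)) (at z)"
    using jet S unfolding wirtinger_jet_def by blast
  have key: "Re (e * (p z * v + q z * cnj v)) = 0 \<and>
      Re (e * (a * v * v + 2 * l z * v * cnj v + b * cnj v * cnj v)) \<le> 0"
    if v: "norm v = 1" for v
  proof -
    define \<phi> where "\<phi> t = Re (e * f (z + of_real t * v))" for t
    define \<phi>' where "\<phi>' t = Re (e * (p (z + of_real t * v) * v + q (z + of_real t * v) * cnj v))" for t
    have aff: "((\<lambda>t. z + of_real t * v) has_derivative (\<lambda>h. of_real h * v)) (at t)" for t
      by (auto intro!: derivative_eq_intros)
    have inS: "z + of_real t * v \<in> S" if "\<bar>t\<bar> < r" for t
      using that r v by (auto simp: dist_norm norm_mult subset_iff)
    have d1: "(\<phi> has_real_derivative \<phi>' t) (at t)" if t: "\<bar>t\<bar> < r" for t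
    proof -
      have "(f has_derivative (\<lambda>w. p (z + of_real t * v) * w + q (z + of_real t * v) * cnj w)) (at (z + of_real t * v))"
        using jet inS[OF t] unfolding wirtinger_jet_def by blast
      from has_derivative_compose[OF aff this]
      have "((\<lambda>t. Re (e * f (z + of_real t * v))) has_derivative
         (\<lambda>h. Re (e * (p (z + of_real t * v) * (of_real h * v) + q (z + of_real t * v) * cnj (of_real h * v))))) (at t)"
        by (intro has_derivative_Re has_derivative_mult_right)
      thus ?thesis unfolding has_field_derivative_def \<phi>_def \<phi>'_def
        by (rule has_derivative_eq_rhs) (auto simp: fun_eq_iff algebra_simps)
    qed
    have d2: "(\<phi>' has_real_derivative Re (e * ((a * v + l z * cnj v) * v + (l z * v + b * cnj v) * cnj v))) (at 0)"
    proof -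
      have "(p has_derivative (\<lambda>w. a * w + l z * cnj w)) (at (z + of_real 0 * v))"
        "(q has_derivative (\<lambda>w. l z * w + b * cnj w)) (at (z + of_real 0 * v))"
        using ab by simp_all
      note has_derivative_compose[OF aff this(1)] has_derivative_compose[OF aff this(2)]
      hence "((\<lambda>t. Re (e * (p (z + of_real t * v) * v + q (z + of_real t * v) * cnj v))) has_derivative
        (\<lambda>h. Re (e * ((a * (of_real h * v) + l z * cnj (of_real h * v)) * v
          + (l z * (of_real h * v) + b * cnj (of_real h * v)) * cnj v)))) (at 0)"
        by (intro has_derivative_Re has_derivative_mult_right has_derivative_add has_derivative_mult_left)
      thus ?thesis unfolding has_field_derivative_def \<phi>'_def
        by (rule has_derivative_eq_rhs) (auto simp: fun_eq_iff algebra_simps)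
    qed
    have "\<phi> t \<le> \<phi> 0" if "\<bar>t\<bar> < r" for t
      using max[OF inS[OF that]] by (simp add: \<phi>_def)
    note second_derivative_test_max[OF r(1) d1 d2 this]
    thus ?thesis by (auto simp: \<phi>'_def algebra_simps)
  qed
  have 1: "Re (e * (p z + q z)) = 0" "Re (e * (a + 2 * l z + b)) \<le> 0"
    using key[of 1] by auto
  have 2: "Re (e * (p z * \<i> - q z * \<i>)) = 0" "Re (e * (- a + 2 * l z - b)) \<le> 0"
    using key[of \<i>] by (auto simp: algebra_simps)
  have "Re (e * (p z * w + q z * cnj w)) =
      Re w * Re (e * (p z + q z)) + Im w * Re (e * (p z * \<i> - q z * \<i>))"
    by (simp add: algebra_simps)
  thus "Re (e * (p z * w + q z * cnj w)) = 0" using 1 2 by simp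
  show "Re (e * l z) \<le> 0" using 1(2) 2(2) by (simp add: algebra_simps)
qed

text \<open>
Rotate \<open>f\<close> by a unimodular \<open>e\<close>. At an interior maximum of the real part of \<open>e f\<close> the first-order terms of the
equation vanish and the second-order term is at most \<open>0\<close>, so that the equation yields
\<open>s\<^sup>2 Re (e f) \<le> |alpha_op s f|\<close>. A maximum above \<open>d\<close> is therefore impossible.
\<close>

lemma alpha_op_maximum_principle:
  assumes jet: "wirtinger_jet (ball 0 \<rho>) f p q l" and cont: "continuous_on (cball 0 \<rho>) f"
    and \<rho>: "0 < \<rho>" "\<rho> \<le> 1" and s: "s \<noteq> 0"
    and small: "\<And>z. norm z < \<rho> \<Longrightarrow> norm (alpha_op s f p q l z) \<le> s\<^sup>2 * d"
    and bd: "\<And>z. norm z = \<rho> \<Longrightarrow> norm (f z) \<le> d"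
    and z: "norm z \<le> \<rho>"
  shows "norm (f z) \<le> d"
proof (rule ccontr)
  assume neg: "\<not> norm (f z) \<le> d"
  have "norm (f (of_real \<rho>)) \<le> d" using bd[of "of_real \<rho>"] \<rho> by simp
  hence d0: "d \<ge> 0" by (rule order_trans[OF norm_ge_zero])
  hence fz: "f z \<noteq> 0" using neg by auto
  \<comment> \<open>rotates the value at the offending point onto the positive real axis\<close>
  define e where "e = cnj (f z) / of_real (norm (f z))"
  have e: "norm e = 1" using fz by (simp add: e_def norm_divide)
  have efz: "Re (e * f z) = norm (f z)"
  proof -
    have "e * f z = of_real (norm (f z))"
      using fz by (simp add: e_def complex_norm_square[symmetric] mult.commute power2_eq_square)
    thus ?thesis by simp
  qed
  have "continuous_on (cball 0 \<rho>) (\<lambda>x. Re (e * f x))"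
    by (intro continuous_intros cont)
  then obtain x where x: "x \<in> cball 0 \<rho>" "\<And>y. y \<in> cball 0 \<rho> \<Longrightarrow> Re (e * f y) \<le> Re (e * f x)"
    using continuous_attains_sup[of "cball 0 \<rho>" "\<lambda>x. Re (e * f x)"] \<rho> by auto
  have big: "Re (e * f x) > d" using x(2)[of z] z neg efz by simp
  have le: "Re (e * y) \<le> norm y" for y
    using complex_Re_le_cmod[of "e * y"] e by (simp add: norm_mult)
  have "norm x \<noteq> \<rho>" using big le[of "f x"] bd[of x] by force
  hence xb: "norm x < \<rho>" using x by simp
  have m: "Re (e * (p x * w + q x * cnj w)) = 0" "Re (e * l x) \<le> 0" for w
    using wirtinger_jet_interior_max(1)[OF jet, where z=x and e=e and w=w]
      wirtinger_jet_interior_max(2)[OF jet, where z=x and e=e] xb x(2) by auto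
  have "Re (e * alpha_op s f p q l x) =
      - s\<^sup>2 * Re (e * f x) + s * Re (e * (p x * x + q x * cnj x)) + (1 - (norm x)\<^sup>2) * Re (e * l x)"
    by (simp add: alpha_op_def algebra_simps)
  also have "\<dots> \<le> - s\<^sup>2 * Re (e * f x)"
    using m(1)[of x] m(2) xb \<rho> by (auto intro!: mult_nonneg_nonpos simp: abs_square_le_1)
  also have "\<dots> < - s\<^sup>2 * d" using big s by simp
  finally have "Re (- e * alpha_op s f p q l x) > s\<^sup>2 * d" by simp
  moreover have "Re (- e * alpha_op s f p q l x) \<le> norm (alpha_op s f p q l x)"
    using complex_Re_le_cmod[of "- e * alpha_op s f p q l x"] e by (simp add: norm_mult)
  ultimately show False using small[OF xb] by simp
qed

section \<open>Taylor coefficients of the radial factors\<close>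

text \<open>
The Taylor coefficients of the hypergeometric function with upper parameters \<open>- s\<close>, \<open>k - s\<close> and lower
parameter \<open>k + 1\<close>.
\<close>

primrec mode_coeff :: "real \<Rightarrow> nat \<Rightarrow> nat \<Rightarrow> real" where
  "mode_coeff s k 0 = 1"
| "mode_coeff s k (Suc n) =
     mode_coeff s k n * ((real n - s) * (real n + real k - s)) / ((real n + 1) * (real n + 1 + real k))"

declare mode_coeff.simps(2) [simp del]

lemma mode_coeff_rec:
  "mode_coeff s k (Suc n) * ((real n + 1) * (real n + 1 + real k)) =
     mode_coeff s k n * ((real n - s) * (real n + real k - s))"
proof -
  have "(real n + 1) * (real n + 1 + real k) > 0" by (intro mult_pos_pos) auto
  thus ?thesis by (simp add: mode_coeff.simps)
qed

lemma abs_mode_coeff_le_one: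
  assumes s: "0 < s" "s < 1"
  shows "\<bar>mode_coeff s k n\<bar> \<le> 1"
proof (induction n)
  case (Suc n)
  have "\<bar>(real n - s) * (real n + real k - s)\<bar> \<le> (real n + 1) * (real n + 1 + real k)"
    unfolding abs_mult by (intro mult_mono) (use s in auto)
  hence "\<bar>mode_coeff s k n\<bar> * \<bar>(real n - s) * (real n + real k - s)\<bar> \<le>
     1 * ((real n + 1) * (real n + 1 + real k))"
    using Suc by (intro mult_mono) auto
  thus ?case by (simp add: mode_coeff.simps abs_mult)
qed auto

lemma mode_coeff_Suc_nonpos:
  assumes s: "0 < s" "s < 1" and k: "k \<ge> 1"
  shows "mode_coeff s k (Suc n) \<le> 0"
proof (induction n)
  case 0
  thus ?case using s k by (auto simp: mode_coeff.simps divide_le_0_iff mult_le_0_iff)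
next
  case (Suc n)
  have "(real (Suc n) - s) * (real (Suc n) + real k - s) \<ge> 0"
    using s by (intro mult_nonneg_nonneg) auto
  thus ?case using Suc mode_coeff.simps(2)[of s k "Suc n"]
    by (simp add: divide_le_0_iff mult_le_0_iff)
qed

lemma mode_coeff_zero_nonneg:
  assumes "0 < s" "s < 1"
  shows "mode_coeff s 0 n \<ge> 0"
  by (induction n) (simp_all add: mode_coeff.simps)

text \<open>
By the recurrence, \<open>n (n + k) b\<^sub>n - (n + 1) (n + k + 1) b\<^sub>n\<^sub>+\<^sub>1 = s (2 n + k - s) b\<^sub>n\<close> for the coefficients
\<open>b\<^sub>n\<close>, so these weighted sums telescope.
\<close>

lemma mode_coeff_telescope_quadratic:
  "s * (\<Sum>n<N. - mode_coeff s k (Suc n) * (2 * real (Suc n) + real k - s)) =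
     s * (real k - s) + mode_coeff s k (Suc N) * ((real N + 1) * (real N + 1 + real k))"
proof (induction N)
  case 0
  show ?case unfolding mode_coeff_rec by (simp add: algebra_simps)
next
  case (Suc N)
  show ?case
    using mode_coeff_rec[of s k "Suc N"] Suc by (simp add: algebra_simps)
qed

text \<open>
The weight \<open>2 n + k - s\<close> is what makes the first derivatives of a mode summable with an explicit bound: it
dominates \<open>n + k\<close> for \<open>n \<ge> 1\<close>.
\<close>

lemma sum_mode_coeff_weighted_le:
  assumes s: "0 < s" "s < 1" and k: "k \<ge> 1"
  shows "(\<Sum>n<N. - mode_coeff s k (Suc n) * (2 * real (Suc n) + real k - s)) \<le> real k - s"
proof -
  have "mode_coeff s k (Suc N) * ((real N + 1) * (real N + 1 + real k)) \<le> 0"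
    using mode_coeff_Suc_nonpos[OF s k, of N] by (intro mult_nonpos_nonneg) auto
  hence "s * (\<Sum>n<N. - mode_coeff s k (Suc n) * (2 * real (Suc n) + real k - s)) \<le> s * (real k - s)"
    using mode_coeff_telescope_quadratic[of s k N] by linarith
  thus ?thesis using s by simp
qed

text \<open>
The weights in \<open>sum_mode_coeff_weighted_le\<close> are at least \<open>k + 2 - s\<close>. For \<open>k = 1\<close> the bound carries a factor
\<open>1 - s\<close>, which the first mode needs; for small \<open>s\<close> it is far from sharp.
\<close>

lemma sum_mode_coeff_le_coarse:
  assumes s: "0 < s" "s < 1" and k: "k \<ge> 1"
  shows "(\<Sum>n<N. - mode_coeff s k (Suc n)) \<le> (real k - s) / (real k + 2 - s)"
proof -
  have "(\<Sum>n<N. - mode_coeff s k (Suc n)) * (real k + 2 - s) \<le>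
      (\<Sum>n<N. - mode_coeff s k (Suc n) * (2 * real (Suc n) + real k - s))"
    unfolding sum_distrib_right
    using mode_coeff_Suc_nonpos[OF s k] by (intro sum_mono mult_left_mono) auto
  also note sum_mode_coeff_weighted_le[OF s k]
  finally show ?thesis using s k by (simp add: field_simps)
qed

text \<open>
Telescoping of \<open>n b\<^sub>n\<close> instead of \<open>n (n + k) b\<^sub>n\<close>. The bound obtained from it tends to \<open>0\<close> with \<open>s\<close>, as the
coefficients themselves do.
\<close>

lemma mode_coeff_telescope_linear:
  "(\<Sum>n<N. - mode_coeff s k (Suc n) *
      ((real (Suc n) + s * (real k + 2 * real (Suc n)) - s\<^sup>2) / (real k + real (Suc n) + 1))) =
     - mode_coeff s k 1 + (real N + 1) * mode_coeff s k (Suc N)"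
proof (induction N)
  case (Suc N)
  define b c where "b = mode_coeff s k (Suc N)" and "c = mode_coeff s k (Suc (Suc N))"
  have pos: "real k + real (Suc N) + 1 \<noteq> 0" "real N + 2 \<noteq> 0" by (simp_all add: add_eq_0_iff)
  have rec: "c * ((real N + 2) * (real N + 2 + real k)) = b * ((real N + 1 - s) * (real N + 1 + real k - s))"
    using mode_coeff_rec[of s k "Suc N"] by (simp add: b_def c_def algebra_simps)
  have "- b * ((real (Suc N) + s * (real k + 2 * real (Suc N)) - s\<^sup>2) / (real k + real (Suc N) + 1)) + (real N + 1) * b
      = (real N + 2) * c"
    using rec pos by (simp add: field_simps power2_eq_square)
  thus ?case using Suc by (simp add: b_def c_def algebra_simps)
qed simp

text \<open>
The weights in \<open>mode_coeff_telescope_linear\<close> increase with \<open>n\<close>, hence each of them is at least the one for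
\<open>n = 1\<close>, called \<open>\<gamma>\<close> below.
\<close>

lemma sum_mode_coeff_le_fine:
  assumes s: "0 < s" "s < 1" and k: "k \<ge> 1"
  shows "(\<Sum>n<N. - mode_coeff s k (Suc n)) \<le> 1 - (1 + s) / (1 + s * (real k + 2) - s\<^sup>2)"
proof -
  define \<gamma> where "\<gamma> = (1 + s * (real k + 2) - s\<^sup>2) / (real k + 2)"
  have s2: "s\<^sup>2 \<le> s" using s by (simp add: power2_eq_square)
  have "s * (real k + 2) \<ge> s * 2" using s by (intro mult_left_mono) auto
  hence pos: "1 + s * (real k + 2) - s\<^sup>2 > 0" using s s2 by linarith
  have ge: "\<gamma> \<le> (real (Suc n) + s * (real k + 2 * real (Suc n)) - s\<^sup>2) / (real k + real (Suc n) + 1)" for n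
  proof -
    have "(real (Suc n) + s * (real k + 2 * real (Suc n)) - s\<^sup>2) * (real k + 2)
        - (1 + s * (real k + 2) - s\<^sup>2) * (real k + real (Suc n) + 1)
       = real n * (real k + 1 + s * real k + 2 * s + s\<^sup>2)"
      by (simp add: algebra_simps power2_eq_square)
    also have "\<dots> \<ge> 0" using s by (intro mult_nonneg_nonneg add_nonneg_nonneg) auto
    finally show ?thesis unfolding \<gamma>_def by (subst frac_le_eq) (auto simp: divide_le_0_iff)
  qed
  have "(\<Sum>n<N. - mode_coeff s k (Suc n)) * \<gamma> \<le> (\<Sum>n<N. - mode_coeff s k (Suc n) *
      ((real (Suc n) + s * (real k + 2 * real (Suc n)) - s\<^sup>2) / (real k + real (Suc n) + 1)))"
    unfolding sum_distrib_right
    using mode_coeff_Suc_nonpos[OF s k] ge by (intro sum_mono mult_left_mono) auto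
  also have "\<dots> \<le> - mode_coeff s k 1"
    unfolding mode_coeff_telescope_linear
    using mode_coeff_Suc_nonpos[OF s k, of N] by (simp add: mult_nonneg_nonpos)
  also have "\<dots> = s * (real k - s) / (real k + 1)"
    by (simp add: mode_coeff.simps)
  finally have "(\<Sum>n<N. - mode_coeff s k (Suc n)) \<le> s * (real k - s) / (real k + 1) / \<gamma>"
    using pos by (subst pos_le_divide_eq) (simp_all add: \<gamma>_def)
  also have "\<dots> = s * (real k - s) * (real k + 2) / ((real k + 1) * (1 + s * (real k + 2) - s\<^sup>2))"
    by (simp add: \<gamma>_def)
  also have "\<dots> \<le> 1 - (1 + s) / (1 + s * (real k + 2) - s\<^sup>2)"
  proof -
    have "(1 + s) * (real k + 1) \<le> real k + 1 + s * real k + 2 * s + s\<^sup>2"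
      using s by (simp add: algebra_simps)
    also have "\<dots> = (real k + 1) * (1 + s * (real k + 2) - s\<^sup>2) - s * (real k - s) * (real k + 2)"
      by (simp add: algebra_simps power2_eq_square)
    finally have "s * (real k - s) * (real k + 2) \<le> (real k + 1) * ((1 + s * (real k + 2) - s\<^sup>2) - (1 + s))"
      by (simp add: algebra_simps)
    hence "s * (real k - s) * (real k + 2) / ((real k + 1) * (1 + s * (real k + 2) - s\<^sup>2)) \<le>
      (real k + 1) * ((1 + s * (real k + 2) - s\<^sup>2) - (1 + s)) / ((real k + 1) * (1 + s * (real k + 2) - s\<^sup>2))"
      using pos by (intro divide_right_mono) auto
    also have "\<dots> = ((1 + s * (real k + 2) - s\<^sup>2) - (1 + s)) / (1 + s * (real k + 2) - s\<^sup>2)"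
      by (rule mult_divide_mult_cancel_left) simp
    also have "\<dots> = 1 - (1 + s) / (1 + s * (real k + 2) - s\<^sup>2)"
      using pos by (subst diff_divide_distrib) simp
    finally show ?thesis .
  qed
  finally show ?thesis .
qed

section \<open>Truncated modes\<close>

definition mode_radial :: "real \<Rightarrow> nat \<Rightarrow> nat \<Rightarrow> real \<Rightarrow> real" where
  "mode_radial s k N t = (\<Sum>n\<le>N. mode_coeff s k n * t ^ n)"

lemma mode_radial_split:
  "mode_radial s k N t = 1 - (\<Sum>n<N. - mode_coeff s k (Suc n) * t ^ Suc n)"
  unfolding mode_radial_def by (subst sum.atMost_shift) (simp add: sum_negf)

lemma mode_radial_le_one:
  assumes "0 < s" "s < 1" "k \<ge> 1" "0 \<le> t"
  shows "mode_radial s k N t \<le> 1"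
  unfolding mode_radial_split using mode_coeff_Suc_nonpos[OF assms(1-3)] assms
  by (simp add: sum_nonneg mult_nonpos_nonneg)

text \<open>
All non-constant terms are at most \<open>0\<close>, so the polynomial is smallest at \<open>t = 1\<close>.
\<close>

lemma mode_radial_ge:
  assumes "0 < s" "s < 1" "k \<ge> 1" "0 \<le> t" "t \<le> 1"
  shows "mode_radial s k N t \<ge> 1 - (\<Sum>n<N. - mode_coeff s k (Suc n))"
proof -
  have "- mode_coeff s k (Suc n) * t ^ Suc n \<le> - mode_coeff s k (Suc n) * 1" for n
    using mode_coeff_Suc_nonpos[OF assms(1-3), of n] assms
    by (intro mult_left_mono power_le_one) auto
  hence "(\<Sum>n<N. - mode_coeff s k (Suc n) * t ^ Suc n) \<le> (\<Sum>n<N. - mode_coeff s k (Suc n))"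
    by (intro sum_mono) simp
  thus ?thesis unfolding mode_radial_split by simp
qed

lemma mode_radial_ge_coarse:
  assumes "0 < s" "s < 1" "k \<ge> 1" "0 \<le> t" "t \<le> 1"
  shows "mode_radial s k N t \<ge> 2 / (real k + 2 - s)"
proof -
  have "2 / (real k + 2 - s) = 1 - (real k - s) / (real k + 2 - s)"
    using assms by (simp add: field_simps)
  thus ?thesis using mode_radial_ge[OF assms] sum_mode_coeff_le_coarse[OF assms(1-3)]
    by (smt (verit))
qed

lemma mode_radial_ge_fine:
  assumes "0 < s" "s < 1" "k \<ge> 1" "0 \<le> t" "t \<le> 1"
  shows "mode_radial s k N t \<ge> (1 + s) / (1 + s * (real k + 2) - s\<^sup>2)"
  using mode_radial_ge[OF assms, of N] sum_mode_coeff_le_fine[OF assms(1-3), of N] by linarith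

text \<open>
For \<open>k = 0\<close> the coefficients are the squares of the generalised binomial coefficients \<open>s gchoose n\<close>. They are
nonnegative and at most \<open>1\<close>, so a geometric series dominates.
\<close>

lemma mode_radial_zero_bounds:
  assumes s: "0 < s" "s < 1" and t: "0 \<le> t" "t \<le> u" "u < 1"
  shows "1 \<le> mode_radial s 0 N t" "mode_radial s 0 N t \<le> 1 / (1 - u)"
proof -
  have "(\<Sum>n<N. - mode_coeff s 0 (Suc n) * t ^ Suc n) \<le> 0"
    using mode_coeff_zero_nonneg[OF s] t by (intro sum_nonpos) (simp add: mult_nonneg_nonneg)
  thus "1 \<le> mode_radial s 0 N t" unfolding mode_radial_split by simp
  have "mode_radial s 0 N t \<le> (\<Sum>n\<le>N. 1 * u ^ n)"
    unfolding mode_radial_def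
    using abs_mode_coeff_le_one[OF s, of 0] t
    by (intro sum_mono mult_mono power_mono) (auto simp: abs_le_iff)
  also have "\<dots> \<le> 1 / (1 - u)"
  proof -
    have "(\<Sum>n\<le>N. u ^ n) * (1 - u) = 1 - u ^ Suc N"
      using sum_gp_basic[of u N] by (simp only: mult.commute)
    also have "\<dots> \<le> 1" using t by simp
    finally show ?thesis using t by (simp add: pos_le_divide_eq)
  qed
  finally show "mode_radial s 0 N t \<le> 1 / (1 - u)" .
qed

text \<open>
A truncation of the solution \<open>F\<^sub>k (|z|\<^sup>2) z ^ k\<close>, written as a polynomial in \<open>z\<close> and \<open>cnj z\<close> so that its
Wirtinger derivatives can be read off term by term.
\<close>

definition mode :: "real \<Rightarrow> nat \<Rightarrow> nat \<Rightarrow> complex \<Rightarrow> complex" where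
  "mode s k N z = (\<Sum>n\<le>N. of_real (mode_coeff s k n) * (z ^ (n + k) * cnj z ^ n))"

definition mode_z where
  "mode_z s k N z = (\<Sum>n\<le>N. of_real (mode_coeff s k n) * (of_nat (n + k) * z ^ (n + k - 1) * cnj z ^ n))"

definition mode_zbar where
  "mode_zbar s k N z = (\<Sum>n\<le>N. of_real (mode_coeff s k n) * (of_nat n * z ^ (n + k) * cnj z ^ (n - 1)))"

definition mode_zzbar where
  "mode_zzbar s k N z = (\<Sum>n\<le>N. of_real (mode_coeff s k n) *
     (of_nat ((n + k) * n) * z ^ (n + k - 1) * cnj z ^ (n - 1)))"

lemma power_mult_cnj_power:
  "z ^ (n + k) * cnj z ^ n = of_real (((norm z)\<^sup>2) ^ n) * z ^ k"
proof -
  have "z ^ (n + k) * cnj z ^ n = (z * cnj z) ^ n * z ^ k"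
    by (simp add: power_add power_mult_distrib)
  thus ?thesis by (simp only: complex_norm_square[symmetric] of_real_power)
qed

lemma mode_eq_radial: "mode s k N z = of_real (mode_radial s k N ((norm z)\<^sup>2)) * z ^ k"
  unfolding mode_def mode_radial_def power_mult_cnj_power
  by (simp add: sum_distrib_right mult.assoc)

lemma wirtinger_jet_mode:
  "wirtinger_jet S (mode s k N) (mode_z s k N) (mode_zbar s k N) (mode_zzbar s k N)"
  unfolding mode_def[abs_def] mode_z_def[abs_def] mode_zbar_def[abs_def] mode_zzbar_def[abs_def]
  by (intro wirtinger_jet_sum wirtinger_jet_cmult wirtinger_jet_monomial)

text \<open>
The operator maps a monomial to a combination of itself and the monomial with both degrees lowered by one. This is
the reason for the two-term recurrence of \<open>mode_coeff\<close>.
\<close>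

lemma alpha_op_monomial:
  defines "P \<equiv> \<lambda>m n. (\<lambda>z. z ^ m * cnj z ^ n)"
  defines "Pz \<equiv> \<lambda>m n. (\<lambda>z. of_nat m * z ^ (m - 1) * cnj z ^ n)"
  defines "Pzb \<equiv> \<lambda>m n. (\<lambda>z. of_nat n * z ^ m * cnj z ^ (n - 1))"
  defines "Pzzb \<equiv> \<lambda>m n. (\<lambda>z. of_nat (m * n) * z ^ (m - 1) * cnj z ^ (n - 1))"
  shows "alpha_op s (P m n) (Pz m n) (Pzb m n) (Pzzb m n) z =
    of_real (- ((real n - s) * (real m - s))) * (z ^ m * cnj z ^ n)
      + of_real (real n * real m) * (z ^ (m - 1) * cnj z ^ (n - 1))"
proof -
  have 1: "of_nat m * (z * z ^ (m - 1)) = of_nat m * z ^ m" by (cases m) auto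
  have 2: "of_nat n * (cnj z * cnj z ^ (n - 1)) = of_nat n * cnj z ^ n" by (cases n) auto
  have 3: "of_nat (m * n) * (z * z ^ (m - 1)) * (cnj z * cnj z ^ (n - 1)) = of_nat (m * n) * z ^ m * cnj z ^ n"
    by (cases m; cases n) auto
  have "z * Pz m n z = (of_nat m * (z * z ^ (m - 1))) * cnj z ^ n" by (simp add: Pz_def)
  hence z: "z * Pz m n z = of_nat m * z ^ m * cnj z ^ n" unfolding 1 .
  have "cnj z * Pzb m n z = (of_nat n * (cnj z * cnj z ^ (n - 1))) * z ^ m" by (simp add: Pzb_def)
  hence zb: "cnj z * Pzb m n z = of_nat n * cnj z ^ n * z ^ m" unfolding 2 .
  have "of_real ((norm z)\<^sup>2) * Pzzb m n z = of_nat (m * n) * (z * z ^ (m - 1)) * (cnj z * cnj z ^ (n - 1))"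
    unfolding Pzzb_def complex_norm_square by (simp add: algebra_simps)
  hence zz: "of_real ((norm z)\<^sup>2) * Pzzb m n z = of_nat (m * n) * z ^ m * cnj z ^ n" unfolding 3 .
  have "alpha_op s (P m n) (Pz m n) (Pzb m n) (Pzzb m n) z =
     - of_real (s\<^sup>2) * P m n z + of_real s * (z * Pz m n z + cnj z * Pzb m n z)
     + Pzzb m n z - of_real ((norm z)\<^sup>2) * Pzzb m n z"
    by (simp add: alpha_op_def algebra_simps)
  also have "\<dots> = of_real (- ((real n - s) * (real m - s))) * (z ^ m * cnj z ^ n)
      + of_real (real n * real m) * (z ^ (m - 1) * cnj z ^ (n - 1))"
    unfolding z zb zz by (simp add: P_def Pzzb_def algebra_simps power2_eq_square)
  finally show ?thesis .
qed

text \<open>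
By the recurrence, the contributions of neighbouring terms cancel; only the image of the last term
survives.
\<close>

lemma alpha_op_mode:
  "alpha_op s (mode s k N) (mode_z s k N) (mode_zbar s k N) (mode_zzbar s k N) z =
     - of_real (mode_coeff s k N * ((real N - s) * (real N + real k - s))) * (z ^ (N + k) * cnj z ^ N)"
proof (induction N)
  case 0
  show ?case
    using alpha_op_monomial[of s k 0 z]
    by (simp add: mode_def[abs_def] mode_z_def[abs_def] mode_zbar_def[abs_def] mode_zzbar_def[abs_def])
next
  case (Suc N)
  define b where "b = mode_coeff s k (Suc N)"
  define m where "m = Suc N + k"
  have "alpha_op s (mode s k (Suc N)) (mode_z s k (Suc N)) (mode_zbar s k (Suc N)) (mode_zzbar s k (Suc N)) z =
    alpha_op s (\<lambda>z. mode s k N z + of_real b * (z ^ m * cnj z ^ Suc N))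
     (\<lambda>z. mode_z s k N z + of_real b * (of_nat m * z ^ (m - 1) * cnj z ^ Suc N))
     (\<lambda>z. mode_zbar s k N z + of_real b * (of_nat (Suc N) * z ^ m * cnj z ^ (Suc N - 1)))
     (\<lambda>z. mode_zzbar s k N z + of_real b * (of_nat (m * Suc N) * z ^ (m - 1) * cnj z ^ (Suc N - 1))) z"
    unfolding mode_def[abs_def] mode_z_def[abs_def] mode_zbar_def[abs_def] mode_zzbar_def[abs_def]
      sum.atMost_Suc b_def m_def ..
  also have "\<dots> = - of_real (mode_coeff s k N * ((real N - s) * (real N + real k - s))) * (z ^ (N + k) * cnj z ^ N)
     + of_real b * (of_real (- ((real (Suc N) - s) * (real m - s))) * (z ^ m * cnj z ^ Suc N)
      + of_real (real (Suc N) * real m) * (z ^ (m - 1) * cnj z ^ (Suc N - 1)))"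
    by (simp only: alpha_op_add alpha_op_cmult alpha_op_monomial Suc)
  also have "\<dots> = - of_real (mode_coeff s k N * ((real N - s) * (real N + real k - s))) * (z ^ (N + k) * cnj z ^ N)
     + of_real (b * (real (Suc N) * real m)) * (z ^ (N + k) * cnj z ^ N)
     + of_real (- (b * ((real (Suc N) - s) * (real m - s)))) * (z ^ m * cnj z ^ Suc N)"
    by (simp add: algebra_simps m_def)
  also have "b * (real (Suc N) * real m) = mode_coeff s k N * ((real N - s) * (real N + real k - s))"
    using mode_coeff_rec[of s k N] by (simp add: b_def m_def algebra_simps)
  finally show ?case by (simp add: b_def m_def algebra_simps)
qed

lemma norm_alpha_op_mode_le:
  assumes s: "0 < s" "s < 1" and z: "norm z \<le> \<rho>" "\<rho> < 1"
  shows "norm (alpha_op s (mode s k N) (mode_z s k N) (mode_zbar s k N) (mode_zzbar s k N) z)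
     \<le> (real N + 1) * (real N + real k + 1) * (\<rho>\<^sup>2) ^ N"
proof -
  have \<rho>: "0 \<le> \<rho>" using z norm_ge_zero[of z] by linarith
  have "norm (alpha_op s (mode s k N) (mode_z s k N) (mode_zbar s k N) (mode_zzbar s k N) z) =
    (\<bar>mode_coeff s k N\<bar> * (\<bar>real N - s\<bar> * \<bar>real N + real k - s\<bar>)) * (((norm z)\<^sup>2) ^ N * norm z ^ k)"
    unfolding alpha_op_mode power_mult_cnj_power norm_mult norm_minus_cancel norm_of_real abs_mult norm_power
    by simp
  also have "\<dots> \<le> (1 * ((real N + 1) * (real N + real k + 1))) * ((\<rho>\<^sup>2) ^ N * 1)"
    using s z \<rho> abs_mode_coeff_le_one[OF s]
    by (intro mult_mono power_mono power_le_one) auto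
  finally show ?thesis by simp
qed

lemma mode_residual_tendsto_0:
  assumes "0 \<le> \<rho>" "\<rho> < 1"
  shows "(\<lambda>N. (real N + 1) * (real N + real k + 1) * (\<rho>\<^sup>2) ^ N) \<longlonglongrightarrow> 0"
proof -
  have \<rho>: "norm \<rho> < 1" using assms by simp
  have 0: "(\<lambda>n. \<rho> ^ n) \<longlonglongrightarrow> 0" by (rule LIMSEQ_power_zero[OF \<rho>])
  have 1: "(\<lambda>n. real n * \<rho> ^ n) \<longlonglongrightarrow> 0" using powser_times_n_limit_0[OF \<rho>] by simp
  have 2: "(\<lambda>N. real N * \<rho> ^ N + c * \<rho> ^ N) \<longlonglongrightarrow> 0 + c * 0" for c
    by (intro tendsto_intros 0 1)
  have "(\<lambda>N. (real N * \<rho> ^ N + 1 * \<rho> ^ N) * (real N * \<rho> ^ N + (real k + 1) * \<rho> ^ N))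
     \<longlonglongrightarrow> (0 + 1 * 0) * (0 + (real k + 1) * 0)"
    by (intro tendsto_mult 2)
  thus ?thesis by (simp add: algebra_simps power2_eq_square power_mult_distrib)
qed

text \<open>
With \<open>t = |z|\<^sup>2\<close> and \<open>F\<close> the radial factor, the two norms are \<open>|k F + t F'|\<close> and \<open>|t F'|\<close>, times
\<open>|z| ^ (k - 1)\<close>. Here \<open>F' \<le> 0 \<le> k F + t F'\<close>, the second inequality being a consequence of
\<open>sum_mode_coeff_weighted_le\<close>. Hence the sum is \<open>k F |z| ^ (k - 1)\<close>, and \<open>F \<le> 1\<close>.
\<close>

lemma norm_mode_derivatives_le:
  assumes s: "0 < s" "s < 1" and k: "k \<ge> 1" and z: "norm z \<le> r" "r \<le> 1"
  shows "norm (mode_z s k N z) + norm (mode_zbar s k N z) \<le> real k * r ^ (k - 1)"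
proof -
  define t where "t = (norm z)\<^sup>2"
  define b where "b n = - mode_coeff s k (Suc n)" for n
  have b: "b n \<ge> 0" for n using mode_coeff_Suc_nonpos[OF s k] by (simp add: b_def)
  have t: "0 \<le> t" "t \<le> 1" using z by (auto simp: t_def intro!: power_le_one)
  define A where "A = (\<Sum>n<N. b n * real (Suc n) * t ^ Suc n)"
  define B where "B = (\<Sum>n<N. b n * t ^ Suc n)"
  have A0: "A \<ge> 0" and B0: "B \<ge> 0"
    unfolding A_def B_def using b t by (auto intro!: sum_nonneg)
  have le: "A + real k * B \<le> real k"
  proof -
    have "A + real k * B = (\<Sum>n<N. b n * (real (Suc n) + real k) * t ^ Suc n)"
      by (simp add: A_def B_def sum_distrib_left sum.distrib[symmetric] algebra_simps)
    also have "\<dots> \<le> (\<Sum>n<N. b n * (2 * real (Suc n) + real k - s) * 1)"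
      using b t s by (intro sum_mono mult_mono power_le_one) auto
    also have "\<dots> \<le> real k - s"
      using sum_mode_coeff_weighted_le[OF s k, of N] by (simp add: b_def)
    finally show ?thesis using s by simp
  qed
  obtain j where j: "k = Suc j" using k by (cases k) auto
  have "mode_z s k N z = of_real (\<Sum>n\<le>N. mode_coeff s k n * (real n + real k) * t ^ n) * z ^ (k - 1)"
    unfolding mode_z_def of_real_sum sum_distrib_right
    using power_mult_cnj_power[of z _ j]
    by (intro sum.cong refl) (simp add: j t_def mult.assoc)
  also have "(\<Sum>n\<le>N. mode_coeff s k n * (real n + real k) * t ^ n) = real k - (A + real k * B)"
    by (subst sum.atMost_shift)
      (simp add: A_def B_def b_def sum_negf[symmetric] sum_distrib_left sum.distrib[symmetric] algebra_simps)
  finally have 1: "norm (mode_z s k N z) = (real k - (A + real k * B)) * norm z ^ (k - 1)"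
    using le by (simp only: norm_mult norm_power norm_of_real)
  have "norm (mode_zbar s k N z) = norm (\<Sum>n<N. of_real (mode_coeff s k (Suc n)) * (of_nat (Suc n) * z ^ (Suc n + k) * cnj z ^ n))"
    unfolding mode_zbar_def by (subst sum.atMost_shift) simp
  also have "\<dots> \<le> (\<Sum>n<N. norm (of_real (mode_coeff s k (Suc n)) * (of_nat (Suc n) * z ^ (Suc n + k) * cnj z ^ n)))"
    by (rule norm_sum)
  also have "\<dots> = A * norm z ^ (k - 1)"
    unfolding A_def sum_distrib_right
  proof (intro sum.cong refl)
    fix n
    have "norm (of_real (mode_coeff s k (Suc n)) * (of_nat (Suc n) * z ^ (Suc n + k) * cnj z ^ n)) =
      b n * real (Suc n) * (norm z ^ (Suc n + k) * norm z ^ n)"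
      using b[of n] by (simp add: norm_mult norm_power b_def del: power_Suc of_nat_Suc)
    also have "norm z ^ (Suc n + k) * norm z ^ n = t ^ Suc n * norm z ^ (k - 1)"
      by (simp add: j t_def power_add[symmetric] power_mult[symmetric] mult_2_right ac_simps del: power_Suc)
    finally show "norm (of_real (mode_coeff s k (Suc n)) * (of_nat (Suc n) * z ^ (Suc n + k) * cnj z ^ n)) =
      b n * real (Suc n) * t ^ Suc n * norm z ^ (k - 1)" by simp
  qed
  finally have "norm (mode_z s k N z) + norm (mode_zbar s k N z) \<le> (real k - real k * B) * norm z ^ (k - 1)"
    using 1 by (simp add: algebra_simps)
  also have "\<dots> \<le> real k * r ^ (k - 1)"
    using z B0 le A0 by (intro mult_mono power_mono) auto
  finally show ?thesis .
qed

lemma mode_lipschitz: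
  assumes s: "0 < s" "s < 1" and k: "k \<ge> 1" and r: "r \<le> 1" and xy: "norm x \<le> r" "norm y \<le> r"
  shows "norm (mode s k N x - mode s k N y) \<le> real k * r ^ (k - 1) * norm (x - y)"
  by (rule wirtinger_jet_lipschitz[OF wirtinger_jet_mode convex_cball[of 0 r] norm_mode_derivatives_le[OF s k _ r]])
    (use xy in auto)

lemma norm_mode_le:
  assumes s: "0 < s" "s < 1" and k: "k \<ge> 1" and z: "norm z \<le> 1"
  shows "norm (mode s k N z) \<le> norm z ^ k"
proof -
  have t: "0 \<le> (norm z)\<^sup>2" "(norm z)\<^sup>2 \<le> 1" using z by (auto intro!: power_le_one)
  have "0 \<le> 2 / (real k + 2 - s)" using s by simp
  also note mode_radial_ge_coarse[OF s k t]
  finally show ?thesis using mode_radial_le_one[OF s k t(1), of N]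
    by (auto simp: mode_eq_radial norm_mult norm_power intro!: mult_left_le_one_le)
qed

text \<open>
The monomial \<open>z ^ (n + 1) cnj z ^ n\<close> has derivative norm \<open>(2 n + 1) |z| ^ (2 n)\<close>, which explains these weights.
They exceed those of \<open>sum_mode_coeff_weighted_le\<close> by \<open>s\<close>.
\<close>

lemma sum_first_mode_weighted_le:
  assumes s: "0 < s" "s < 1"
  shows "(\<Sum>n<N. - mode_coeff s 1 (Suc n) * (2 * real (Suc n) + 1)) \<le> 3 * (1 - s) / (3 - s)"
proof -
  have "(\<Sum>n<N. - mode_coeff s 1 (Suc n) * (2 * real (Suc n) + 1)) =
     (\<Sum>n<N. - mode_coeff s 1 (Suc n) * (2 * real (Suc n) + real 1 - s)) + s * (\<Sum>n<N. - mode_coeff s 1 (Suc n))"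
    by (simp add: sum_distrib_left sum.distrib[symmetric] algebra_simps)
  also have "\<dots> \<le> (1 - s) + s * ((1 - s) / (3 - s))"
    using sum_mode_coeff_weighted_le[OF s, of 1 N] sum_mode_coeff_le_coarse[OF s, of 1 N] s
    by (intro add_mono mult_left_mono) auto
  also have "\<dots> = 3 * (1 - s) / (3 - s)" using s by (simp add: field_simps)
  finally show ?thesis .
qed

lemma first_mode_minus_id:
  "mode s 1 N z - z = (\<Sum>n<N. of_real (mode_coeff s 1 (Suc n)) * (z ^ (n + 2) * cnj z ^ Suc n))"
  unfolding mode_def by (subst sum.atMost_shift) simp

lemma first_mode_lipschitz:
  assumes s: "0 < s" "s < 1" and r: "r \<le> 1" and xy: "norm x \<le> r" "norm y \<le> r"
  shows "norm ((mode s 1 N x - x) - (mode s 1 N y - y)) \<le> 3 * (1 - s) / (3 - s) * r\<^sup>2 * norm (x - y)"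
  unfolding first_mode_minus_id
proof (rule wirtinger_jet_lipschitz[where S="cball 0 r"])
  show "wirtinger_jet (cball 0 r) (\<lambda>z. \<Sum>n<N. of_real (mode_coeff s 1 (Suc n)) * (z ^ (n + 2) * cnj z ^ Suc n))
    (\<lambda>z. \<Sum>n<N. of_real (mode_coeff s 1 (Suc n)) * (of_nat (n + 2) * z ^ (n + 2 - 1) * cnj z ^ Suc n))
    (\<lambda>z. \<Sum>n<N. of_real (mode_coeff s 1 (Suc n)) * (of_nat (Suc n) * z ^ (n + 2) * cnj z ^ (Suc n - 1)))
    (\<lambda>z. \<Sum>n<N. of_real (mode_coeff s 1 (Suc n)) * (of_nat ((n + 2) * Suc n) * z ^ (n + 2 - 1) * cnj z ^ (Suc n - 1)))"
    by (intro wirtinger_jet_sum wirtinger_jet_cmult wirtinger_jet_monomial)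
  fix z :: complex assume "z \<in> cball 0 r"
  hence z: "norm z \<le> r" by simp
  have b: "- mode_coeff s 1 (Suc n) \<ge> 0" for n using mode_coeff_Suc_nonpos[OF s, of 1] by simp
  have pw: "norm z ^ (2 * n + 2) \<le> r\<^sup>2" for n
  proof -
    have "norm z ^ (2 * n + 2) \<le> norm z ^ 2" using z r by (intro power_decreasing) auto
    also have "\<dots> \<le> r\<^sup>2" using z by (intro power_mono) auto
    finally show ?thesis .
  qed
  have "norm (\<Sum>n<N. of_real (mode_coeff s 1 (Suc n)) * (of_nat (n + 2) * z ^ (n + 2 - 1) * cnj z ^ Suc n)) +
    norm (\<Sum>n<N. of_real (mode_coeff s 1 (Suc n)) * (of_nat (Suc n) * z ^ (n + 2) * cnj z ^ (Suc n - 1)))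
    \<le> (\<Sum>n<N. - mode_coeff s 1 (Suc n) * (real (n + 2) * norm z ^ (2 * n + 2))) +
      (\<Sum>n<N. - mode_coeff s 1 (Suc n) * (real (Suc n) * norm z ^ (2 * n + 2)))"
  proof (intro add_mono order_trans[OF norm_sum] sum_mono)
    fix n
    have e: "norm (of_real (mode_coeff s 1 (Suc n)) * (of_nat c * z ^ i * cnj z ^ j)) =
      - mode_coeff s 1 (Suc n) * (real c * norm z ^ (i + j))" for c i j
      using b[of n] unfolding norm_mult norm_of_real norm_of_nat norm_power complex_mod_cnj power_add by simp
    show "norm (of_real (mode_coeff s 1 (Suc n)) * (of_nat (n + 2) * z ^ (n + 2 - 1) * cnj z ^ Suc n))
      \<le> - mode_coeff s 1 (Suc n) * (real (n + 2) * norm z ^ (2 * n + 2))"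
      unfolding e by (simp add: mult_2)
    show "norm (of_real (mode_coeff s 1 (Suc n)) * (of_nat (Suc n) * z ^ (n + 2) * cnj z ^ (Suc n - 1)))
      \<le> - mode_coeff s 1 (Suc n) * (real (Suc n) * norm z ^ (2 * n + 2))"
      unfolding e by (simp add: mult_2)
  qed
  also have "\<dots> = (\<Sum>n<N. - mode_coeff s 1 (Suc n) * (2 * real (Suc n) + 1) * norm z ^ (2 * n + 2))"
    unfolding sum.distrib[symmetric] by (intro sum.cong refl) (simp add: algebra_simps)
  also have "\<dots> \<le> (\<Sum>n<N. - mode_coeff s 1 (Suc n) * (2 * real (Suc n) + 1) * r\<^sup>2)"
    using pw b by (intro sum_mono mult_left_mono mult_nonneg_nonneg) auto
  also have "\<dots> \<le> 3 * (1 - s) / (3 - s) * r\<^sup>2"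
    unfolding sum_distrib_right[symmetric]
    by (intro mult_right_mono sum_first_mode_weighted_le s) auto
  finally show "norm (\<Sum>n<N. of_real (mode_coeff s 1 (Suc n)) * (of_nat (n + 2) * z ^ (n + 2 - 1) * cnj z ^ Suc n)) +
    norm (\<Sum>n<N. of_real (mode_coeff s 1 (Suc n)) * (of_nat (Suc n) * z ^ (n + 2) * cnj z ^ (Suc n - 1)))
    \<le> 3 * (1 - s) / (3 - s) * r\<^sup>2" .
qed (use xy in auto)

lemma norm_first_mode_minus_id_le:
  assumes s: "0 < s" "s < 1" and z: "norm z \<le> 1"
  shows "norm (mode s 1 N z - z) \<le> (1 - s) / (3 - s) * (norm z)\<^sup>2 * norm z"
proof -
  define t where "t = (norm z)\<^sup>2"
  have t: "0 \<le> t" "t \<le> 1" using z by (auto simp: t_def intro!: power_le_one)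
  have b: "- mode_coeff s 1 (Suc n) \<ge> 0" for n using mode_coeff_Suc_nonpos[OF s, of 1] by simp
  have "mode s 1 N z - z = of_real (mode_radial s 1 N t - 1) * z"
    by (simp add: mode_eq_radial t_def algebra_simps)
  hence "norm (mode s 1 N z - z) = (1 - mode_radial s 1 N t) * norm z"
    using mode_radial_le_one[OF s _ t(1), of 1 N] by (simp only: norm_mult norm_of_real) simp
  also have "1 - mode_radial s 1 N t = (\<Sum>n<N. - mode_coeff s 1 (Suc n) * t ^ Suc n)"
    by (simp add: mode_radial_split)
  also have "\<dots> \<le> (\<Sum>n<N. - mode_coeff s 1 (Suc n) * t)"
    using t b by (intro sum_mono mult_left_mono) (auto intro!: mult_left_le power_le_one)
  also have "\<dots> = (\<Sum>n<N. - mode_coeff s 1 (Suc n)) * t" by (rule sum_distrib_right[symmetric])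
  also have "\<dots> \<le> (1 - s) / (3 - s) * t"
    using sum_mode_coeff_le_coarse[OF s, of 1 N] t by (intro mult_right_mono) auto
  finally show ?thesis by (simp add: t_def mult_right_mono)
qed

lemma mode_at_0: "mode s k N 0 = (if k = 0 then 1 else 0)"
  by (simp add: mode_eq_radial mode_radial_split)

text \<open>
A positive lower bound that depends neither on the truncation order \<open>N\<close> nor on \<open>\<rho>\<close>.
\<close>

lemma mode_radial_lower_bound:
  assumes s: "0 < s" "s < 1" and \<rho>: "0 < \<rho>" "\<rho> < 1"
  shows "mode_radial s k N (\<rho>\<^sup>2) \<ge> (if k = 0 then 1 else 2 / (real k + 2 - s))"
proof -
  have t: "0 \<le> \<rho>\<^sup>2" "\<rho>\<^sup>2 < 1" using \<rho> by (auto simp: abs_square_less_1)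
  show ?thesis
    using mode_radial_ge_coarse[OF s _ t(1), of k N] mode_radial_zero_bounds(1)[OF s t(1) order_refl t(2)] t by auto
qed

section \<open>Trigonometric approximation on the circle\<close>

text \<open>
On the unit circle \<open>cnj \<zeta> = 1 / \<zeta>\<close>, so a real polynomial in the two coordinates is a Laurent polynomial in
\<open>\<zeta>\<close>. Clearing the denominator makes closure under products immediate.
\<close>

lemma real_polynomial_on_circle:
  fixes g :: "complex \<Rightarrow> real"
  assumes "real_polynomial_function g"
  shows "\<exists>P K. \<forall>\<zeta>. norm \<zeta> = 1 \<longrightarrow> of_real (g \<zeta>) * \<zeta> ^ K = poly P \<zeta>"
  using assms
proof (induction rule: real_polynomial_function.induct)
  case (linear h)
  define a b where "a = complex_of_real (h 1)" and "b = complex_of_real (h \<i>)"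
  have "of_real (h \<zeta>) * \<zeta> ^ 1 = poly [: a / 2 + \<i> * b / 2, 0, a / 2 - \<i> * b / 2 :] \<zeta>"
    if \<zeta>: "norm \<zeta> = 1" for \<zeta>
  proof -
    interpret bounded_linear h by fact
    have "h \<zeta> = h (Re \<zeta> *\<^sub>R 1 + Im \<zeta> *\<^sub>R \<i>)"
      by (rule arg_cong[of _ _ h]) (simp add: complex_eq_iff)
    also have "\<dots> = Re \<zeta> * h 1 + Im \<zeta> * h \<i>" by (simp only: add scaleR) simp
    finally have h: "h \<zeta> = Re \<zeta> * h 1 + Im \<zeta> * h \<i>" .
    have c: "\<zeta> * cnj \<zeta> = 1" using \<zeta> by (simp add: complex_norm_square[symmetric])
    have re: "of_real (Re \<zeta>) = (\<zeta> + cnj \<zeta>) / 2" and im: "of_real (Im \<zeta>) = \<i> * (cnj \<zeta> - \<zeta>) / 2"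
      by (auto simp: complex_eq_iff)
    have "of_real (h \<zeta>) * \<zeta> ^ 1 = ((\<zeta> + cnj \<zeta>) / 2 * a + \<i> * (cnj \<zeta> - \<zeta>) / 2 * b) * \<zeta>"
      by (simp add: h a_def b_def re im)
    also have "\<dots> = (\<zeta> * \<zeta> + \<zeta> * cnj \<zeta>) / 2 * a + \<i> * (\<zeta> * cnj \<zeta> - \<zeta> * \<zeta>) / 2 * b"
      by (simp add: algebra_simps)
    also have "\<dots> = poly [: a / 2 + \<i> * b / 2, 0, a / 2 - \<i> * b / 2 :] \<zeta>"
      unfolding c by (simp add: algebra_simps diff_divide_distrib add_divide_distrib)
    finally show ?thesis .
  qed
  thus ?case by blast
next
  case (const c)
  show ?case by (rule exI[of _ "[:of_real c:]"], rule exI[of _ 0]) simp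
next
  case (add f g)
  then obtain P K Q L where
    1: "\<And>\<zeta>. norm \<zeta> = 1 \<Longrightarrow> of_real (f \<zeta>) * \<zeta> ^ K = poly P \<zeta>" and
    2: "\<And>\<zeta>. norm \<zeta> = 1 \<Longrightarrow> of_real (g \<zeta>) * \<zeta> ^ L = poly Q \<zeta>" by blast
  have "of_real (f \<zeta> + g \<zeta>) * \<zeta> ^ (K + L) = poly (P * monom 1 L + Q * monom 1 K) \<zeta>"
    if "norm \<zeta> = 1" for \<zeta>
    unfolding poly_add poly_mult poly_monom 1[OF that, symmetric] 2[OF that, symmetric]
    by (simp add: power_add algebra_simps)
  thus ?case by blast
next
  case (mult f g)
  then obtain P K Q L where
    1: "\<And>\<zeta>. norm \<zeta> = 1 \<Longrightarrow> of_real (f \<zeta>) * \<zeta> ^ K = poly P \<zeta>" and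
    2: "\<And>\<zeta>. norm \<zeta> = 1 \<Longrightarrow> of_real (g \<zeta>) * \<zeta> ^ L = poly Q \<zeta>" by blast
  have "of_real (f \<zeta> * g \<zeta>) * \<zeta> ^ (K + L) = poly (P * Q) \<zeta>"
    if "norm \<zeta> = 1" for \<zeta>
    unfolding poly_mult 1[OF that, symmetric] 2[OF that, symmetric]
    by (simp add: power_add algebra_simps)
  thus ?case by blast
qed

lemma polynomial_on_circle:
  fixes g :: "complex \<Rightarrow> complex"
  assumes "polynomial_function g"
  obtains P K where "\<And>\<zeta>. norm \<zeta> = 1 \<Longrightarrow> g \<zeta> * \<zeta> ^ K = poly P \<zeta>"
proof -
  have "real_polynomial_function (Re \<circ> g)" "real_polynomial_function (Im \<circ> g)"
    using assms bounded_linear_Re bounded_linear_Im unfolding polynomial_function_def by blast+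
  from this[THEN real_polynomial_on_circle] obtain P K Q L where
    1: "\<And>\<zeta>. norm \<zeta> = 1 \<Longrightarrow> of_real (Re (g \<zeta>)) * \<zeta> ^ K = poly P \<zeta>" and
    2: "\<And>\<zeta>. norm \<zeta> = 1 \<Longrightarrow> of_real (Im (g \<zeta>)) * \<zeta> ^ L = poly Q \<zeta>"
    unfolding o_def by blast
  have "g \<zeta> * \<zeta> ^ (K + L) = poly (P * monom 1 L + smult \<i> (Q * monom 1 K)) \<zeta>"
    if "norm \<zeta> = 1" for \<zeta>
  proof -
    have "g \<zeta> * \<zeta> ^ (K + L) = (of_real (Re (g \<zeta>)) + \<i> * of_real (Im (g \<zeta>))) * \<zeta> ^ (K + L)"
      by (simp only: complex_eq[symmetric])
    also have "\<dots> = (of_real (Re (g \<zeta>)) * \<zeta> ^ K) * \<zeta> ^ L + \<i> * ((of_real (Im (g \<zeta>)) * \<zeta> ^ L) * \<zeta> ^ K)"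
      by (simp add: power_add algebra_simps)
    also have "\<dots> = poly (P * monom 1 L + smult \<i> (Q * monom 1 K)) \<zeta>"
      unfolding 1[OF that] 2[OF that] by (simp add: poly_monom)
    finally show ?thesis .
  qed
  thus ?thesis by (rule that)
qed

lemma sum_powers_root_of_unity:
  fixes x :: complex
  assumes "x ^ M = 1" "x \<noteq> 1"
  shows "(\<Sum>m<M. x ^ m) = 0"
  using assms by (simp add: geometric_sum)

text \<open>
Cauchy's estimate. Averaging \<open>poly P \<zeta> / \<zeta> ^ j\<close> over the roots of unity of an order larger than the degree
isolates the coefficient exactly.
\<close>

lemma norm_coeff_le_sup_on_circle:
  fixes P :: "complex poly"
  assumes B: "\<And>\<zeta>. norm \<zeta> = 1 \<Longrightarrow> norm (poly P \<zeta>) \<le> B"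
  shows "norm (coeff P j) \<le> B"
proof (cases "j \<le> degree P")
  case False
  have "0 \<le> norm (poly P 1)" by simp
  also have "\<dots> \<le> B" using B[of 1] by simp
  finally show ?thesis using False by (simp add: coeff_eq_0)
next
  case True
  define M where "M = Suc (degree P)"
  define \<omega> where "\<omega> = exp (2 * of_real pi * \<i> * of_nat 1 / of_nat M)"
  have M: "1 \<le> M" by (simp add: M_def)
  have pw: "\<omega> ^ i = exp (2 * of_real pi * \<i> * of_nat i / of_nat M)" for i
    by (simp add: \<omega>_def exp_of_nat_mult[symmetric] mult_ac)
  have one: "\<omega> ^ i = 1 \<longleftrightarrow> M dvd i" for i
    unfolding pw by (rule complex_root_unity_eq_1[OF M])
  have \<omega>: "norm \<omega> = 1" by (simp add: \<omega>_def norm_exp_eq_Re)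
  have inner: "(\<Sum>m<M. (\<omega> ^ (i + (M - j))) ^ m) = (if i = j then of_nat M else 0)" if i: "i \<le> degree P" for i
  proof (cases "i = j")
    case True
    have "\<omega> ^ (i + (M - j)) = 1" unfolding one using \<open>j \<le> degree P\<close> True by (simp add: M_def)
    thus ?thesis using True by simp
  next
    case False
    have "\<not> M dvd i + (M - j)"
    proof
      assume "M dvd i + (M - j)"
      then obtain q where q: "i + (M - j) = M * q" by blast
      have "i + (M - j) < 2 * M" "i + (M - j) > 0" using i \<open>j \<le> degree P\<close> by (auto simp: M_def)
      hence "q = 1" using q by (metis One_nat_def less_2_cases mult.commute mult_0_right mult_less_cancel1 not_less_zero)
      thus False using q False \<open>j \<le> degree P\<close> by (simp add: M_def)
    qed
    hence "\<omega> ^ (i + (M - j)) \<noteq> 1" by (simp add: one)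
    moreover have "(\<omega> ^ (i + (M - j))) ^ M = 1"
      using one[of M] by (metis dvd_refl power_mult mult.commute power_one)
    ultimately show ?thesis using False sum_powers_root_of_unity by simp
  qed
  have "(\<Sum>m<M. poly P (\<omega> ^ m) * (\<omega> ^ m) ^ (M - j)) =
      (\<Sum>m<M. \<Sum>i\<le>degree P. coeff P i * (\<omega> ^ (i + (M - j))) ^ m)"
    unfolding poly_altdef sum_distrib_right
    by (intro sum.cong refl) (simp add: power_mult[symmetric] power_add[symmetric] mult.assoc algebra_simps)
  also have "\<dots> = (\<Sum>i\<le>degree P. coeff P i * (\<Sum>m<M. (\<omega> ^ (i + (M - j))) ^ m))"
    unfolding sum_distrib_left by (rule sum.swap)
  also have "\<dots> = (\<Sum>i\<le>degree P. coeff P i * (if i = j then of_nat M else 0))"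
    using inner by (intro sum.cong) auto
  also have "\<dots> = (\<Sum>i\<le>degree P. if i = j then coeff P j * of_nat M else 0)"
    by (intro sum.cong) auto
  also have "\<dots> = coeff P j * of_nat M" using True by simp
  finally have "norm (coeff P j * of_nat M) = norm (\<Sum>m<M. poly P (\<omega> ^ m) * (\<omega> ^ m) ^ (M - j))" by simp
  also have "\<dots> \<le> (\<Sum>m<M. B)"
    using B \<omega> by (intro order_trans[OF norm_sum] sum_mono) (simp add: norm_mult norm_power)
  finally have "norm (coeff P j) * real M \<le> B * real M" by (simp add: norm_mult mult.commute)
  thus ?thesis using M by simp
qed

lemma sum_symmetric_split:
  fixes F :: "nat \<Rightarrow> 'a::comm_monoid_add"
  shows "(\<Sum>j\<le>2 * L. F j) = F L + (\<Sum>k=1..L. F (L + k) + F (L - k))"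
proof -
  have "(\<Sum>k=1..L. F (L + k)) = (\<Sum>j\<in>{L<..2 * L}. F j)"
    by (rule sum.reindex_bij_witness[of _ "\<lambda>j. j - L" "\<lambda>k. L + k"]) auto
  moreover have "(\<Sum>k=1..L. F (L - k)) = (\<Sum>j\<in>{..<L}. F j)"
    by (rule sum.reindex_bij_witness[of _ "\<lambda>j. L - j" "\<lambda>k. L - k"]) auto
  moreover have "{..2 * L} = insert L ({L<..2 * L} \<union> {..<L})" by auto
  hence "(\<Sum>j\<le>2 * L. F j) = F L + ((\<Sum>j\<in>{L<..2 * L}. F j) + (\<Sum>j\<in>{..<L}. F j))"
    by (simp add: sum.union_disjoint disjoint_iff)
  ultimately show ?thesis by (simp add: sum.distrib)
qed

text \<open>
The Stone--Weierstrass theorem provides a polynomial in the coordinates, which is a Laurent polynomial on the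
circle; the coefficients of the latter are bounded by its supremum, hence by \<open>B + e\<close>.
\<close>

lemma trigonometric_approximation:
  fixes g :: "complex \<Rightarrow> complex"
  assumes cont: "continuous_on (sphere 0 1) g" and e: "e > 0"
    and B: "\<And>\<zeta>. norm \<zeta> = 1 \<Longrightarrow> norm (g \<zeta>) \<le> B"
  obtains K A C where
    "\<And>\<zeta>. norm \<zeta> = 1 \<Longrightarrow> norm (g \<zeta> - (A 0 + (\<Sum>k=1..K. A k * \<zeta> ^ k + C k * cnj \<zeta> ^ k))) \<le> e"
    "\<And>k. norm (A k) \<le> B + e" "\<And>k. norm (C k) \<le> B + e" "K \<ge> 1"
proof -
  obtain h where h: "polynomial_function h" "\<And>\<zeta>. \<zeta> \<in> sphere 0 1 \<Longrightarrow> norm (g \<zeta> - h \<zeta>) < e"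
    using Stone_Weierstrass_polynomial_function[OF _ cont e] by auto
  obtain P K where P: "\<And>\<zeta>. norm \<zeta> = 1 \<Longrightarrow> h \<zeta> * \<zeta> ^ K = poly P \<zeta>"
    using polynomial_on_circle[OF h(1)] by blast
  \<comment> \<open>At least \<open>K\<close> and at least the degree, so that the powers range over \<open>{- L..L}\<close>; the successor makes \<open>L\<close> positive.\<close>
  define L where "L = Suc (max K (degree P))"
  define Q where "Q = monom 1 (L - K) * P"
  have Q: "h \<zeta> * \<zeta> ^ L = poly Q \<zeta>" if "norm \<zeta> = 1" for \<zeta>
  proof -
    have "h \<zeta> * \<zeta> ^ L = \<zeta> ^ (L - K) * (h \<zeta> * \<zeta> ^ K)"
      by (simp add: L_def power_add[symmetric] mult.left_commute del: power_Suc)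
    thus ?thesis using P[OF that] by (simp add: Q_def poly_monom)
  qed
  have "degree Q \<le> (L - K) + degree P"
    unfolding Q_def by (metis add_mono degree_monom_le degree_mult_le le_refl order_trans)
  hence deg: "degree Q \<le> 2 * L" by (simp add: L_def)
  have polyQ: "poly Q \<zeta> = (\<Sum>j\<le>2 * L. coeff Q j * \<zeta> ^ j)" for \<zeta>
    unfolding poly_altdef using deg by (intro sum.mono_neutral_left) (auto simp: coeff_eq_0)
  have hb: "norm (h \<zeta>) \<le> B + e" if "norm \<zeta> = 1" for \<zeta>
    using h(2)[of \<zeta>] B[OF that] that norm_triangle_ineq3[of "h \<zeta>" "g \<zeta>"]
    by (auto simp: norm_minus_commute)
  have cb: "norm (coeff Q j) \<le> B + e" for j
  proof (rule norm_coeff_le_sup_on_circle)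
    fix \<zeta> :: complex assume "norm \<zeta> = 1"
    thus "norm (poly Q \<zeta>) \<le> B + e" using hb Q[of \<zeta>] by (metis mult.right_neutral norm_mult norm_power power_one)
  qed
  have heq: "h \<zeta> = coeff Q (L + 0) + (\<Sum>k=1..L. coeff Q (L + k) * \<zeta> ^ k + coeff Q (L - k) * cnj \<zeta> ^ k)"
    if \<zeta>: "norm \<zeta> = 1" for \<zeta>
  proof -
    have c: "\<zeta> * cnj \<zeta> = 1" using \<zeta> by (simp add: complex_norm_square[symmetric])
    have c2: "\<zeta> ^ i * cnj \<zeta> ^ i = 1" for i
      unfolding power_mult_distrib[symmetric] c by simp
    have "h \<zeta> = h \<zeta> * \<zeta> ^ L * cnj \<zeta> ^ L" using c2[of L] by (simp add: mult.assoc)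
    also have "\<dots> = (\<Sum>j\<le>2 * L. coeff Q j * \<zeta> ^ j * cnj \<zeta> ^ L)"
      unfolding Q[OF \<zeta>] polyQ sum_distrib_right ..
    also have "\<dots> = coeff Q L * (\<zeta> ^ L * cnj \<zeta> ^ L) + (\<Sum>k=1..L. coeff Q (L + k) * \<zeta> ^ k * (\<zeta> ^ L * cnj \<zeta> ^ L)
       + coeff Q (L - k) * (\<zeta> ^ (L - k) * cnj \<zeta> ^ (L - k)) * cnj \<zeta> ^ k)"
      unfolding sum_symmetric_split
      by (intro arg_cong2[where f="(+)"] sum.cong refl)
        (auto simp: power_add[symmetric] mult.assoc mult.left_commute, simp add: power_add mult.left_commute)
    finally show ?thesis unfolding c2 by simp
  qed
  show ?thesis
  proof (rule that[where A="\<lambda>k. coeff Q (L + k)" and K=L and C="\<lambda>k. coeff Q (L - k)"])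
    fix \<zeta> :: complex assume "norm \<zeta> = 1"
    thus "norm (g \<zeta> - (coeff Q (L + 0) + (\<Sum>k=1..L. coeff Q (L + k) * \<zeta> ^ k + coeff Q (L - k) * cnj \<zeta> ^ k))) \<le> e"
      using h(2)[of \<zeta>] heq[of \<zeta>] by simp
  qed (use cb in \<open>auto simp: L_def\<close>)
qed

section \<open>Approximation of solutions by modes\<close>

text \<open>
On the circle of radius \<open>\<rho>\<close> the approximating trigonometric polynomial equals a combination \<open>u\<close> of truncated
modes, each normalised by the value of its radial factor at \<open>\<rho>\<^sup>2\<close>. The maximum principle applied to \<open>f - u\<close>
carries the approximation into the disc. The mode with \<open>k = 0\<close> is small because \<open>f 0 = 0\<close>, and is dropped.
\<close>

lemma approximation_by_modes:
  assumes s: "0 < s" "s < 1"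
    and jet: "wirtinger_jet (ball 0 1) f p q l"
    and harm: "\<And>z. norm z < 1 \<Longrightarrow> alpha_op s f p q l z = 0"
    and bound: "\<And>z. norm z < 1 \<Longrightarrow> norm (f z) \<le> \<Lambda> * norm z"
    and \<rho>: "0 < \<rho>" "\<rho> < 1" and \<delta>: "\<delta> > 0" and \<Lambda>: "\<Lambda> \<ge> 0"
  obtains K N A C where "K \<ge> 1"
    "\<And>z. norm z \<le> \<rho> \<Longrightarrow>
        norm (f z - (\<Sum>k=1..K. A k * mode s k N z + C k * cnj (mode s k N z))) \<le> \<delta>"
    "\<And>k. k \<ge> 1 \<Longrightarrow> norm (A k) \<le> (\<Lambda> + \<delta>) / (\<rho> ^ (k - 1) * mode_radial s k N (\<rho>\<^sup>2))"
    "\<And>k. k \<ge> 1 \<Longrightarrow> norm (C k) \<le> (\<Lambda> + \<delta>) / (\<rho> ^ (k - 1) * mode_radial s k N (\<rho>\<^sup>2))"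
proof -
  have t: "0 \<le> \<rho>\<^sup>2" "\<rho>\<^sup>2 < 1" using \<rho> by (auto simp: abs_square_less_1)
  \<comment> \<open>Small enough that \<open>\<Lambda> \<rho> + \<epsilon> \<le> (\<Lambda> + \<delta>) \<rho>\<close> and that dropping the zeroth mode costs at most \<open>\<delta> - \<epsilon>\<close>.\<close>
  define \<epsilon> where "\<epsilon> = \<delta> * \<rho> * (1 - \<rho>\<^sup>2) / 2"
  have \<epsilon>: "\<epsilon> > 0" using \<delta> \<rho> t by (simp add: \<epsilon>_def)
  have "- 1 \<le> \<rho>\<^sup>2" by (rule order_trans[OF _ zero_le_power2]) simp
  hence "(1 - \<rho>\<^sup>2) / 2 \<le> 1" by simp
  hence \<epsilon>1: "\<epsilon> \<le> \<delta> * \<rho>"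
    using mult_left_mono[of "(1 - \<rho>\<^sup>2) / 2" 1 "\<delta> * \<rho>"] \<delta> \<rho> by (simp add: \<epsilon>_def)
  have \<epsilon>2: "\<epsilon> + \<epsilon> * (1 / (1 - \<rho>\<^sup>2)) \<le> \<delta>"
  proof -
    have "\<epsilon> + \<epsilon> * (1 / (1 - \<rho>\<^sup>2)) = \<delta> * (\<rho> * (1 - \<rho>\<^sup>2) / 2 + \<rho> / 2)"
      using t by (simp add: \<epsilon>_def field_simps)
    also have "\<dots> \<le> \<delta> * 1"
    proof (intro mult_left_mono)
      have "\<rho> * (1 - \<rho>\<^sup>2) \<le> 1 * 1" using \<rho> t(2) zero_le_power2[of \<rho>] by (intro mult_mono) linarith+
      thus "\<rho> * (1 - \<rho>\<^sup>2) / 2 + \<rho> / 2 \<le> 1" using \<rho> by simp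
    qed (use \<delta> in simp)
    finally show ?thesis by simp
  qed
  have contf: "continuous_on (ball 0 1) f" by (rule wirtinger_jet_imp_continuous_on[OF jet])
  have contg: "continuous_on (sphere 0 1) (\<lambda>\<zeta>. f (of_real \<rho> * \<zeta>))"
    by (rule continuous_on_compose2[OF contf])
      (use \<rho> in \<open>auto intro!: continuous_intros simp: norm_mult\<close>)
  have boundg: "norm (f (of_real \<rho> * \<zeta>)) \<le> \<Lambda> * \<rho>" if "norm \<zeta> = 1" for \<zeta>
    using bound[of "of_real \<rho> * \<zeta>"] that \<rho> by (simp add: norm_mult)
  obtain K a c where K: "K \<ge> 1" and
    ac: "\<And>\<zeta>. norm \<zeta> = 1 \<Longrightarrow> norm (f (of_real \<rho> * \<zeta>) - (a 0 + (\<Sum>k=1..K. a k * \<zeta> ^ k + c k * cnj \<zeta> ^ k))) \<le> \<epsilon>"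
    and a: "\<And>k. norm (a k) \<le> \<Lambda> * \<rho> + \<epsilon>" and c: "\<And>k. norm (c k) \<le> \<Lambda> * \<rho> + \<epsilon>"
    by (rule trigonometric_approximation[OF contg \<epsilon> boundg], assumption) (rule that)
  define R where "R N k = mode_radial s k N (\<rho>\<^sup>2)" for N k
  define w where "w k = (if k = 0 then 1 else 2 / (real k + 2 - s))" for k :: nat
  have w: "w k > 0" for k using s by (auto simp: w_def)
  have R: "R N k \<ge> w k" for N k unfolding R_def w_def by (rule mode_radial_lower_bound[OF s \<rho>])
  have R0: "R N k > 0" for N k using R[of k N] w[of k] by linarith
  define A where "A N k = a k / of_real (\<rho> ^ k * R N k)" for N k
  define C where "C N k = c k / of_real (\<rho> ^ k * R N k)" for N k
  \<comment> \<open>These bounds do not involve \<open>N\<close>, so \<open>N\<close> can be chosen afterwards to make the residual small.\<close>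
  define M where "M k = (\<Lambda> * \<rho> + \<epsilon>) / (\<rho> ^ k * w k)" for k
  have num: "\<Lambda> * \<rho> + \<epsilon> \<ge> 0" using \<Lambda> \<rho> \<epsilon> by simp
  have fr: "norm (x / of_real (\<rho> ^ k * R N k)) \<le> M k" if "norm x \<le> \<Lambda> * \<rho> + \<epsilon>" for x :: complex and N k
  proof -
    have "norm (x / of_real (\<rho> ^ k * R N k)) = norm x / (\<rho> ^ k * R N k)"
      using \<rho> R0[of N k] by (simp add: norm_divide norm_mult norm_power)
    also have "\<dots> \<le> M k"
      unfolding M_def using that \<rho> w[of k] R[of k N] num
      by (intro frac_le mult_left_mono mult_pos_pos) auto
    finally show ?thesis .
  qed
  have AM: "norm (A N k) \<le> M k" and CM: "norm (C N k) \<le> M k" for N k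
    unfolding A_def C_def using fr a c by blast+
  have M0: "M k \<ge> 0" for k using AM[of 0 k] norm_ge_zero[of "A 0 k"] by linarith
  define rr where "rr k N = (real N + 1) * (real N + real k + 1) * (\<rho>\<^sup>2) ^ N" for k N
  have "(\<lambda>N. M 0 * rr 0 N + (\<Sum>k=1..K. 2 * M k * rr k N)) \<longlonglongrightarrow> M 0 * 0 + (\<Sum>k=1..K. 2 * M k * 0)"
    unfolding rr_def using \<rho> by (intro tendsto_intros mode_residual_tendsto_0) auto
  hence "\<forall>\<^sub>F N in sequentially. M 0 * rr 0 N + (\<Sum>k=1..K. 2 * M k * rr k N) < s\<^sup>2 * \<epsilon>"
    by (rule order_tendstoD) (use s \<epsilon> in simp)
  then obtain N where N: "M 0 * rr 0 N + (\<Sum>k=1..K. 2 * M k * rr k N) < s\<^sup>2 * \<epsilon>"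
    by (meson eventually_sequentially order_refl)
  define u where "u = (\<lambda>z. A N 0 * mode s 0 N z + (\<Sum>k=1..K. A N k * mode s k N z + C N k * cnj (mode s k N z)))"
  define up where "up = (\<lambda>z. A N 0 * mode_z s 0 N z + (\<Sum>k=1..K. A N k * mode_z s k N z + C N k * cnj (mode_zbar s k N z)))"
  define uq where "uq = (\<lambda>z. A N 0 * mode_zbar s 0 N z + (\<Sum>k=1..K. A N k * mode_zbar s k N z + C N k * cnj (mode_z s k N z)))"
  define ul where "ul = (\<lambda>z. A N 0 * mode_zzbar s 0 N z + (\<Sum>k=1..K. A N k * mode_zzbar s k N z + C N k * cnj (mode_zzbar s k N z)))"
  define res where "res k z = alpha_op s (mode s k N) (mode_z s k N) (mode_zbar s k N) (mode_zzbar s k N) z" for k z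
  have jetu: "wirtinger_jet S u up uq ul" for S
    unfolding u_def up_def uq_def ul_def
    by (intro wirtinger_jet_add wirtinger_jet_sum wirtinger_jet_cmult wirtinger_jet_cnj wirtinger_jet_mode)
  have opu: "alpha_op s u up uq ul z = A N 0 * res 0 z + (\<Sum>k=1..K. A N k * res k z + C N k * cnj (res k z))" for z
    unfolding u_def up_def uq_def ul_def alpha_op_add alpha_op_sum alpha_op_cmult alpha_op_cnj res_def ..
  have resb: "norm (res k z) \<le> rr k N" if "norm z \<le> \<rho>" for k z
    unfolding res_def rr_def by (rule norm_alpha_op_mode_le[OF s that \<rho>(2)])
  have opu_small: "norm (alpha_op s u up uq ul z) \<le> s\<^sup>2 * \<epsilon>" if z: "norm z \<le> \<rho>" for z
  proof -
    have "norm (alpha_op s u up uq ul z) \<le> norm (A N 0 * res 0 z) + (\<Sum>k=1..K. norm (A N k * res k z + C N k * cnj (res k z)))"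
      unfolding opu by (rule norm_triangle_le[OF add_left_mono[OF norm_sum]])
    also have "\<dots> \<le> M 0 * rr 0 N + (\<Sum>k=1..K. 2 * M k * rr k N)"
    proof (intro add_mono sum_mono)
      show "norm (A N 0 * res 0 z) \<le> M 0 * rr 0 N"
        unfolding norm_mult by (intro mult_mono AM resb z M0 norm_ge_zero)
      fix k
      have "norm (A N k * res k z + C N k * cnj (res k z)) \<le> norm (A N k) * norm (res k z) + norm (C N k) * norm (res k z)"
        using norm_triangle_ineq[of "A N k * res k z" "C N k * cnj (res k z)"] by (simp add: norm_mult)
      also have "\<dots> \<le> M k * rr k N + M k * rr k N"
        by (intro add_mono mult_mono AM CM resb z M0 norm_ge_zero)
      finally show "norm (A N k * res k z + C N k * cnj (res k z)) \<le> 2 * M k * rr k N" by simp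
    qed
    finally show ?thesis using N by linarith
  qed
  have near: "norm (f z - u z) \<le> \<epsilon>" if z: "norm z \<le> \<rho>" for z
  proof -
    define d where "d = (\<lambda>z. f z + (- 1) * u z)"
    define dp where "dp = (\<lambda>z. p z + (- 1) * up z)"
    define dq where "dq = (\<lambda>z. q z + (- 1) * uq z)"
    define dl where "dl = (\<lambda>z. l z + (- 1) * ul z)"
    have jd: "wirtinger_jet (ball 0 1) d dp dq dl"
      unfolding d_def dp_def dq_def dl_def by (intro wirtinger_jet_add wirtinger_jet_cmult jet jetu)
    have op: "alpha_op s d dp dq dl x = alpha_op s f p q l x + (- 1) * alpha_op s u up uq ul x" for x
      unfolding d_def dp_def dq_def dl_def alpha_op_add alpha_op_cmult ..
    have "norm (d z) \<le> \<epsilon>"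
    proof (rule alpha_op_maximum_principle[of \<rho> d dp dq dl s \<epsilon>])
      show "wirtinger_jet (ball 0 \<rho>) d dp dq dl"
        by (rule wirtinger_jet_subset[OF jd]) (use \<rho> in auto)
      show "continuous_on (cball 0 \<rho>) d"
        by (rule continuous_on_subset[OF wirtinger_jet_imp_continuous_on[OF jd]]) (use \<rho> in auto)
      show "norm (alpha_op s d dp dq dl x) \<le> s\<^sup>2 * \<epsilon>" if "norm x < \<rho>" for x
        using opu_small[of x] harm[of x] that \<rho> by (simp add: op)
      fix x :: complex assume x: "norm x = \<rho>"
      define \<zeta> where "\<zeta> = x / of_real \<rho>"
      have \<zeta>: "norm \<zeta> = 1" "x = of_real \<rho> * \<zeta>" using x \<rho> by (auto simp: \<zeta>_def norm_divide)
      have m: "mode s k N x = of_real (\<rho> ^ k * R N k) * \<zeta> ^ k" for k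
        unfolding mode_eq_radial x R_def by (simp add: \<zeta>(2) power_mult_distrib)
      have nz: "of_real (\<rho> ^ k * R N k) \<noteq> (0::complex)" for k
        using R0[of N k] \<rho> by simp
      have am: "A N k * mode s k N x = a k * \<zeta> ^ k" for k
        unfolding A_def m using nz[of k] \<rho> by simp
      have cm: "C N k * cnj (mode s k N x) = c k * cnj \<zeta> ^ k" for k
        unfolding C_def m using nz[of k] \<rho> by simp
      have ux: "u x = a 0 + (\<Sum>k=1..K. a k * \<zeta> ^ k + c k * cnj \<zeta> ^ k)"
        unfolding u_def am cm by simp
      have "d x = f x - u x" by (simp add: d_def)
      thus "norm (d x) \<le> \<epsilon>" using ac[OF \<zeta>(1)] by (simp only: ux \<zeta>(2)[symmetric])
    qed (use z \<rho> s in auto)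
    thus ?thesis by (simp add: d_def)
  qed
  have "f 0 = 0" using bound[of 0] by simp
  moreover have "u 0 = A N 0"
    unfolding u_def mode_at_0 by simp
  ultimately have A0: "norm (A N 0) \<le> \<epsilon>" using near[of 0] \<rho> by simp
  have AC: "norm (x / of_real (\<rho> ^ k * R N k)) \<le> (\<Lambda> + \<delta>) / (\<rho> ^ (k - 1) * R N k)"
    if x: "norm x \<le> \<Lambda> * \<rho> + \<epsilon>" and k: "k \<ge> 1" for x :: complex and k
  proof -
    obtain j where j: "k = Suc j" using k by (cases k) auto
    have "norm (x / of_real (\<rho> ^ k * R N k)) = norm x / (\<rho> ^ k * R N k)"
      using \<rho> R0[of N k] by (simp add: norm_divide norm_mult norm_power)
    also have "\<dots> \<le> (\<Lambda> + \<delta>) * \<rho> / (\<rho> ^ k * R N k)"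
      using x \<epsilon>1 \<rho> R0[of N k] by (intro divide_right_mono) (auto simp: algebra_simps)
    also have "\<dots> = (\<Lambda> + \<delta>) / (\<rho> ^ (k - 1) * R N k)"
      using \<rho> by (simp add: j)
    finally show ?thesis .
  qed
  show ?thesis
  proof (rule that[where K=K and N=N and A="A N" and C="C N"])
    fix z :: complex assume z: "norm z \<le> \<rho>"
    have t2: "0 \<le> (norm z)\<^sup>2" "(norm z)\<^sup>2 \<le> \<rho>\<^sup>2" using z by (auto intro: power_mono)
    have m0: "norm (A N 0 * mode s 0 N z) \<le> \<epsilon> * (1 / (1 - \<rho>\<^sup>2))"
      unfolding norm_mult
    proof (intro mult_mono A0)
      show "norm (mode s 0 N z) \<le> 1 / (1 - \<rho>\<^sup>2)"
        using mode_radial_zero_bounds[OF s t2 t(2), of N] by (simp add: mode_eq_radial)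
    qed (use \<epsilon> in auto)
    have "f z - (\<Sum>k=1..K. A N k * mode s k N z + C N k * cnj (mode s k N z)) =
       (f z - u z) + A N 0 * mode s 0 N z" by (simp add: u_def)
    also have "norm \<dots> \<le> \<epsilon> + \<epsilon> * (1 / (1 - \<rho>\<^sup>2))"
      by (rule norm_triangle_le[OF add_mono[OF near[OF z] m0]])
    also note \<epsilon>2
    finally show "norm (f z - (\<Sum>k=1..K. A N k * mode s k N z + C N k * cnj (mode s k N z))) \<le> \<delta>" .
  next
    fix k :: nat assume k: "k \<ge> 1"
    show "norm (A N k) \<le> (\<Lambda> + \<delta>) / (\<rho> ^ (k - 1) * mode_radial s k N (\<rho>\<^sup>2))"
      "norm (C N k) \<le> (\<Lambda> + \<delta>) / (\<rho> ^ (k - 1) * mode_radial s k N (\<rho>\<^sup>2))"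
      unfolding A_def C_def R_def[symmetric] using AC a c k by blast+
  qed (rule K)
qed

section \<open>The Gamma quotient and the geometric sums\<close>

text \<open>
The point \<open>1 + 2 s\<close> divides the interval from \<open>1 + s\<close> to \<open>2 + s\<close> in the ratio \<open>s : 1 - s\<close>. Convexity of
\<open>ln \<circ> Gamma\<close> therefore gives \<open>Gamma (1 + 2 s) \<le> Gamma (1 + s) (1 + s) powr s\<close>, and the last factor is at most
\<open>1 + s\<^sup>2\<close> by concavity of the logarithm.
\<close>

lemma Gamma_ratio_ge:
  fixes s :: real
  assumes s: "0 < s" "s < 1"
  shows "1 - s / 2 \<le> Gamma (s + 1) / Gamma (1 + 2 * s)"
proof -
  have pos: "Gamma (s + 1) > 0" "Gamma (1 + 2 * s) > 0" "Gamma (s + 2) > 0" using s by (auto intro!: Gamma_real_pos)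
  have "ln (Gamma ((1 - s) *\<^sub>R (s + 1) + s *\<^sub>R (s + 2))) \<le> (1 - s) * ln (Gamma (s + 1)) + s * ln (Gamma (s + 2))"
    using convex_onD[OF log_convex_Gamma_real, of s "s + 1" "s + 2"] s by simp
  moreover have "(1 - s) *\<^sub>R (s + 1) + s *\<^sub>R (s + 2) = 1 + 2 * s" by (simp add: algebra_simps)
  moreover have "Gamma (s + 2) = (s + 1) * Gamma (s + 1)"
    using Gamma_plus1[of "s + 1"] nonpos_Ints_nonpos[of "s + 1"] s by (force simp: add.assoc)
  ultimately have "ln (Gamma (1 + 2 * s)) \<le> (1 - s) * ln (Gamma (s + 1)) + s * ln ((s + 1) * Gamma (s + 1))" by simp
  also have "\<dots> = ln (Gamma (s + 1)) + s * ln (1 + s)"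
  proof -
    have "ln ((s + 1) * Gamma (s + 1)) = ln (s + 1) + ln (Gamma (s + 1))"
      by (rule ln_mult_pos) (use s pos in auto)
    thus ?thesis by (simp add: algebra_simps)
  qed
  also have "\<dots> \<le> ln (Gamma (s + 1)) + ln (1 + s\<^sup>2)"
  proof -
    have "(1 - s) * ln 1 + s * ln (1 + s) \<le> ln ((1 - s) *\<^sub>R 1 + s *\<^sub>R (1 + s))"
      using concave_onD[OF ln_concave, of s 1 "1 + s"] s by simp
    also have "(1 - s) *\<^sub>R 1 + s *\<^sub>R (1 + s) = 1 + s\<^sup>2"
      by (simp add: algebra_simps power2_eq_square)
    finally show ?thesis by simp
  qed
  also have "\<dots> = ln (Gamma (s + 1) * (1 + s\<^sup>2))"
    using pos by (intro ln_mult_pos[symmetric] add_pos_nonneg) auto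
  finally have "Gamma (1 + 2 * s) \<le> Gamma (s + 1) * (1 + s\<^sup>2)"
    using pos by (subst (asm) ln_le_cancel_iff) (auto intro!: mult_pos_pos add_pos_nonneg)
  hence "1 * Gamma (1 + 2 * s) \<le> Gamma (s + 1) * (1 + s\<^sup>2)" by simp
  moreover have pos2: "1 + s\<^sup>2 > 0" by (intro add_pos_nonneg) auto
  ultimately have "1 / (1 + s\<^sup>2) \<le> Gamma (s + 1) / Gamma (1 + 2 * s)"
    using pos by (simp only: frac_le_eq divide_le_0_iff pos_le_divide_eq pos_divide_le_eq times_divide_eq_left)
  moreover have "1 - s / 2 \<le> 1 / (1 + s\<^sup>2)"
  proof -
    have "(1 - s / 2) * (1 + s\<^sup>2) = 1 - s / 2 * (1 - s)\<^sup>2"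
      by (simp add: algebra_simps power2_eq_square)
    also have "\<dots> \<le> 1" using s by simp
    finally show ?thesis by (simp only: pos_le_divide_eq[OF pos2])
  qed
  ultimately show ?thesis by linarith
qed

text \<open>
The left-hand side is the reciprocal of the lower bound in \<open>mode_radial_ge_fine\<close>. With \<open>1 - s / 2\<close> in place of \<open>a\<close>, and
after clearing denominators, the difference of the two sides is affine in \<open>k\<close>; its value at \<open>k = 2\<close> and its slope are polynomials in \<open>s\<close>
that are nonnegative on the unit interval.
\<close>

lemma inverse_radial_bound_le_Gamma_ratio:
  fixes s a :: real
  assumes s: "0 < s" "s < 1" and a: "1 - s / 2 \<le> a" and k: "k \<ge> 2"
  shows "(1 + s * (real k + 2) - s\<^sup>2) / (1 + s) \<le> a * (real k + 1) / (2 * (1 - s))"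
proof -
  define j where "j = real k - 2"
  have j: "j \<ge> 0" "real k = j + 2" using k by (auto simp: j_def)
  \<comment> \<open>the difference at \<open>k = 2\<close>; completing the square shows its sign\<close>
  have "1 - 4.5 * s + 8.5 * s\<^sup>2 - 2 * s ^ 3 = 2 * s\<^sup>2 * (1 - s) + 6.5 * (s - 9 / 26)\<^sup>2 + 23 / 104"
    by (simp add: power2_eq_square power3_eq_cube field_simps)
  also have "\<dots> \<ge> 0" using s by (intro add_nonneg_nonneg) auto
  finally have 1: "0 \<le> 1 - 4.5 * s + 8.5 * s\<^sup>2 - 2 * s ^ 3" .
  have "1 - 1.5 * s + 1.5 * s\<^sup>2 = 1.5 * (s - 1/2)\<^sup>2 + 5 / 8"
    by (simp add: power2_eq_square field_simps)
  also have "\<dots> \<ge> 0" by simp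
  finally have 2: "0 \<le> j * (1 - 1.5 * s + 1.5 * s\<^sup>2)" using j by simp
  have "(1 - s / 2) * (1 + s) * (real k + 1) - 2 * (1 - s) * (1 + s * (real k + 2) - s\<^sup>2) =
    (1 - 4.5 * s + 8.5 * s\<^sup>2 - 2 * s ^ 3) + j * (1 - 1.5 * s + 1.5 * s\<^sup>2)"
    unfolding j(2) by (simp add: power2_eq_square power3_eq_cube field_simps)
  hence "2 * (1 - s) * (1 + s * (real k + 2) - s\<^sup>2) \<le> (1 - s / 2) * (1 + s) * (real k + 1)"
    using 1 2 by linarith
  also have "\<dots> \<le> a * (1 + s) * (real k + 1)"
    using s a by (intro mult_right_mono) auto
  finally show ?thesis using s by (simp add: field_simps)
qed

text \<open>
The full series from \<open>k = 1\<close> has the value \<open>2 / (1 - R) ^ 3\<close>, and its first term is \<open>2\<close>.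
\<close>

lemma sum_quadratic_geometric_le:
  fixes R :: real
  assumes R: "0 \<le> R" "R < 1"
  shows "(\<Sum>k=2..K. real k * (real k + 1) * R ^ (k - 1)) \<le> 2 / (1 - R) ^ 3 - 2"
proof -
  \<comment> \<open>The bracket is the numerator of the tail, visibly nonnegative for \<open>0 \<le> R < 1\<close>.\<close>
  have closed: "(\<Sum>k<n. (real k + 1) * (real k + 2) * R ^ k) * (1 - R) ^ 3 =
     2 - R ^ n * ((real n)\<^sup>2 * (1 - R)\<^sup>2 + real n * (1 - R) * (3 - R) + 2)" for n
  proof (induction n)
    case (Suc n)
    have "(\<Sum>k<Suc n. (real k + 1) * (real k + 2) * R ^ k) * (1 - R) ^ 3 =
       (\<Sum>k<n. (real k + 1) * (real k + 2) * R ^ k) * (1 - R) ^ 3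
         + (real n + 1) * (real n + 2) * R ^ n * (1 - R) ^ 3"
      unfolding sum.lessThan_Suc by (rule distrib_right)
    thus ?case unfolding Suc
      by (simp add: power2_eq_square power3_eq_cube algebra_simps)
  qed simp
  have "(\<Sum>k<n. (real k + 1) * (real k + 2) * R ^ k) * (1 - R) ^ 3 \<le> 2" for n
    unfolding closed using R by (auto intro!: mult_nonneg_nonneg add_nonneg_nonneg)
  hence le: "(\<Sum>k<n. (real k + 1) * (real k + 2) * R ^ k) \<le> 2 / (1 - R) ^ 3" for n
    using R by (simp add: pos_le_divide_eq)
  show ?thesis
  proof (cases K)
    case 0
    thus ?thesis using le[of 1] by simp
  next
    case (Suc n)
    have "(\<Sum>k<Suc n. (real k + 1) * (real k + 2) * R ^ k) =
       2 + (\<Sum>k<n. (real (Suc k) + 1) * (real (Suc k) + 2) * R ^ Suc k)"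
      by (subst sum.lessThan_Suc_shift) simp
    also have "(\<Sum>k<n. (real (Suc k) + 1) * (real (Suc k) + 2) * R ^ Suc k) =
       (\<Sum>k=2..K. real k * (real k + 1) * R ^ (k - 1))"
      by (rule sum.reindex_bij_witness[of _ "\<lambda>k. k - 2" "\<lambda>k. k + 2"]) (auto simp: Suc algebra_simps)
    finally show ?thesis using le[of "Suc n"] by simp
  qed
qed

text \<open>
The bound produced by the modes: the first summand comes from \<open>k = 1\<close>, the second one from all \<open>k \<ge> 2\<close>. The factor
\<open>c\<close> is \<open>3\<close> for the Lipschitz constant and \<open>1\<close> for the values. Two radii occur because the higher modes are
normalised on a circle of radius less than \<open>1\<close>, which replaces \<open>r\<close> by \<open>r\<close> divided by that radius.
\<close>

definition mode_majorant :: "real \<Rightarrow> real \<Rightarrow> real \<Rightarrow> real \<Rightarrow> real \<Rightarrow> real" where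
  "mode_majorant s a c r R = c * (1 - s) * r\<^sup>2 + a / (1 - s) * (2 / (1 - R) ^ 3 - 2)"

section \<open>Deviation from the derivative at the origin\<close>

lemma norm_conjugate_pair_le:
  fixes A C u v :: complex
  assumes "norm A \<le> M" "norm C \<le> M" "norm u \<le> L"
  shows "norm (A * u + C * cnj u) \<le> 2 * M * L"
proof -
  have "norm (A * u + C * cnj u) \<le> norm A * norm u + norm C * norm u"
    using norm_triangle_ineq[of "A * u" "C * cnj u"] by (simp add: norm_mult)
  also have "\<dots> \<le> M * L + M * L"
    using assms order_trans[OF norm_ge_zero assms(1)] by (intro add_mono mult_mono) auto
  finally show ?thesis by (simp add: mult_ac)
qed

text \<open>
Splitting off the linear parts of the two first modes leaves a remainder \<open>h\<close> whose mode-wise bounds add up to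
\<open>mode_majorant\<close>.
\<close>

lemma linear_approximation:
  assumes s: "0 < s" "s < 1" and a: "1 - s / 2 \<le> a"
    and jet: "wirtinger_jet (ball 0 1) f p q l"
    and harm: "\<And>z. norm z < 1 \<Longrightarrow> alpha_op s f p q l z = 0"
    and bound: "\<And>z. norm z < 1 \<Longrightarrow> norm (f z) \<le> \<Lambda> * norm z"
    and \<rho>: "0 < \<rho>" "\<rho> < 1" and \<delta>: "\<delta> > 0" and \<Lambda>: "\<Lambda> \<ge> 0"
  obtains A C h where
    "\<And>z. norm z \<le> \<rho> \<Longrightarrow> norm (f z - (A * z + C * cnj z + h z)) \<le> \<delta>"
    "norm A \<le> (\<Lambda> + \<delta>) * ((3 - s) / 2)" "norm C \<le> (\<Lambda> + \<delta>) * ((3 - s) / 2)"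
    "\<And>x y r. norm x \<le> r \<Longrightarrow> norm y \<le> r \<Longrightarrow> r < \<rho> \<Longrightarrow>
       norm (h x - h y) \<le> (\<Lambda> + \<delta>) * mode_majorant s a 3 r (r / \<rho>) * norm (x - y)"
    "\<And>z. norm z < \<rho> \<Longrightarrow>
       norm (h z) \<le> (\<Lambda> + \<delta>) * mode_majorant s a 1 (norm z) (norm z / \<rho>) * norm z"
proof -
  obtain K N A C where K: "K \<ge> 1"
    and near: "\<And>z. norm z \<le> \<rho> \<Longrightarrow>
        norm (f z - (\<Sum>k=1..K. A k * mode s k N z + C k * cnj (mode s k N z))) \<le> \<delta>"
    and A: "\<And>k. k \<ge> 1 \<Longrightarrow> norm (A k) \<le> (\<Lambda> + \<delta>) / (\<rho> ^ (k - 1) * mode_radial s k N (\<rho>\<^sup>2))"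
    and C: "\<And>k. k \<ge> 1 \<Longrightarrow> norm (C k) \<le> (\<Lambda> + \<delta>) / (\<rho> ^ (k - 1) * mode_radial s k N (\<rho>\<^sup>2))"
    by (rule approximation_by_modes[OF s jet harm bound \<rho> \<delta> \<Lambda>], assumption, assumption) (rule that)
  have t: "0 \<le> \<rho>\<^sup>2" "\<rho>\<^sup>2 \<le> 1" using \<rho> by (auto intro: power_le_one)
  define L where "L = \<Lambda> + \<delta>"
  have L: "L > 0" using \<Lambda> \<delta> by (simp add: L_def)
  define M where "M k = L / (\<rho> ^ (k - 1) * mode_radial s k N (\<rho>\<^sup>2))" for k
  have rad: "mode_radial s k N (\<rho>\<^sup>2) > 0" if "k \<ge> 1" for k
    using mode_radial_ge_coarse[OF s that t, of N] s
    by (smt (verit) divide_pos_pos of_nat_0_le_iff)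
  have M1: "M 1 \<le> L * ((3 - s) / 2)"
  proof -
    have "M 1 = L / mode_radial s 1 N (\<rho>\<^sup>2)" by (simp add: M_def)
    also have "\<dots> \<le> L / (2 / (3 - s))"
      using mode_radial_ge_coarse[OF s _ t, of 1 N] s L by (intro divide_left_mono mult_pos_pos rad) auto
    finally show ?thesis by simp
  qed
  have Mk: "2 * M k \<le> L * (a / (1 - s)) * (real k + 1) / \<rho> ^ (k - 1)" if k: "k \<ge> 2" for k
  proof -
    have s2: "s\<^sup>2 \<le> s" using s by (simp add: power2_eq_square)
    have "s * (real k + 2) \<ge> s * 2" using s by (intro mult_left_mono) auto
    hence pos: "1 + s * (real k + 2) - s\<^sup>2 > 0" using s s2 by linarith
    have "M k = L / mode_radial s k N (\<rho>\<^sup>2) / \<rho> ^ (k - 1)" by (simp add: M_def)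
    also have "\<dots> \<le> L / ((1 + s) / (1 + s * (real k + 2) - s\<^sup>2)) / \<rho> ^ (k - 1)"
      using mode_radial_ge_fine[OF s _ t, of k N] s L k pos \<rho>
      by (intro divide_right_mono divide_left_mono mult_pos_pos rad) auto
    also have "\<dots> = L * ((1 + s * (real k + 2) - s\<^sup>2) / (1 + s)) / \<rho> ^ (k - 1)" by simp
    also have "\<dots> \<le> L * (a * (real k + 1) / (2 * (1 - s))) / \<rho> ^ (k - 1)"
      using inverse_radial_bound_le_Gamma_ratio[OF s a k] L \<rho> by (intro divide_right_mono mult_left_mono) auto
    also have "\<dots> = (L * (a / (1 - s)) * (real k + 1) / \<rho> ^ (k - 1)) / 2"
      using s \<rho> by (simp add: field_simps)
    finally show ?thesis by (subst (asm) pos_le_divide_eq) (simp_all only: mult.commute zero_less_numeral)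
  qed
  have AM: "norm (A k) \<le> M k" and CM: "norm (C k) \<le> M k" if "k \<ge> 1" for k
    using A[OF that] C[OF that] by (simp_all add: M_def L_def)
  have a0: "a / (1 - s) \<ge> 0" using a s by simp
  define g where "g z = mode s 1 N z - z" for z
  define h where "h z = (A 1 * g z + C 1 * cnj (g z)) +
     (\<Sum>k=2..K. A k * mode s k N z + C k * cnj (mode s k N z))" for z
  have split: "(\<Sum>k=1..K. A k * mode s k N z + C k * cnj (mode s k N z)) = A 1 * z + C 1 * cnj z + h z" for z
  proof -
    have "{1..K} = insert 1 {2..K}" using K by auto
    thus ?thesis by (simp add: h_def g_def algebra_simps)
  qed
  have higher: "(\<Sum>k=2..K. 2 * M k * (real k * r ^ (k - 1))) \<le> L * (a / (1 - s) * (2 / (1 - r / \<rho>) ^ 3 - 2))"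
    if r: "0 \<le> r" "r < \<rho>" for r
  proof -
    have "(\<Sum>k=2..K. 2 * M k * (real k * r ^ (k - 1))) \<le>
       (\<Sum>k=2..K. (L * (a / (1 - s)) * (real k + 1) / \<rho> ^ (k - 1)) * (real k * r ^ (k - 1)))"
      using r by (intro sum_mono mult_right_mono Mk) auto
    also have "\<dots> = L * (a / (1 - s)) * (\<Sum>k=2..K. real k * (real k + 1) * (r / \<rho>) ^ (k - 1))"
    proof -
      have "(c * x / P) * (y * w) = c * (y * x * (w / P))" for c x P y w :: real by simp
      thus ?thesis unfolding sum_distrib_left power_divide by (intro sum.cong refl)
    qed
    also have "\<dots> \<le> L * (a / (1 - s)) * (2 / (1 - r / \<rho>) ^ 3 - 2)"
      using r \<rho> L a0 by (intro mult_left_mono sum_quadratic_geometric_le mult_nonneg_nonneg) auto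
    finally show ?thesis by simp
  qed
  show ?thesis
  proof (rule that[of "A 1" "C 1" h])
    show "norm (f z - (A 1 * z + C 1 * cnj z + h z)) \<le> \<delta>" if "norm z \<le> \<rho>" for z
      using near[OF that] unfolding split .
    show "norm (A 1) \<le> (\<Lambda> + \<delta>) * ((3 - s) / 2)" "norm (C 1) \<le> (\<Lambda> + \<delta>) * ((3 - s) / 2)"
      using order_trans[OF AM M1] order_trans[OF CM M1] by (simp_all add: L_def)
  next
    fix x y :: complex and r :: real
    assume xy: "norm x \<le> r" "norm y \<le> r" and r\<rho>: "r < \<rho>"
    have r: "0 \<le> r" "r \<le> 1" using xy(1) r\<rho> \<rho> order_trans[OF norm_ge_zero xy(1)] by auto
    have "h x - h y = (A 1 * (g x - g y) + C 1 * cnj (g x - g y)) +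
      (\<Sum>k=2..K. A k * (mode s k N x - mode s k N y) + C k * cnj (mode s k N x - mode s k N y))"
      by (simp add: h_def sum_subtractf[symmetric] algebra_simps)
    hence "norm (h x - h y) \<le> norm (A 1 * (g x - g y) + C 1 * cnj (g x - g y)) +
      (\<Sum>k=2..K. norm (A k * (mode s k N x - mode s k N y) + C k * cnj (mode s k N x - mode s k N y)))"
      by (simp only:) (rule norm_triangle_le[OF add_left_mono[OF norm_sum]])
    also have "\<dots> \<le> 2 * M 1 * (3 * (1 - s) / (3 - s) * r\<^sup>2 * norm (x - y)) +
      (\<Sum>k=2..K. 2 * M k * (real k * r ^ (k - 1) * norm (x - y)))"
    proof (intro add_mono sum_mono norm_conjugate_pair_le AM CM)
      show "norm (g x - g y) \<le> 3 * (1 - s) / (3 - s) * r\<^sup>2 * norm (x - y)"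
        unfolding g_def by (rule first_mode_lipschitz[OF s r(2) xy])
      show "norm (mode s k N x - mode s k N y) \<le> real k * r ^ (k - 1) * norm (x - y)"
        if "k \<in> {2..K}" for k
        by (rule mode_lipschitz[OF s _ r(2) xy]) (use that in simp)
    qed simp_all
    also have "\<dots> = (2 * M 1 * (3 * (1 - s) / (3 - s) * r\<^sup>2) +
      (\<Sum>k=2..K. 2 * M k * (real k * r ^ (k - 1)))) * norm (x - y)"
      by (simp add: sum_distrib_right distrib_right mult.assoc)
    also have "\<dots> \<le> (2 * (L * ((3 - s) / 2)) * (3 * (1 - s) / (3 - s) * r\<^sup>2) +
      L * (a / (1 - s) * (2 / (1 - r / \<rho>) ^ 3 - 2))) * norm (x - y)"
      using s by (intro mult_right_mono add_mono higher[OF r(1) r\<rho>] mult_left_mono M1) auto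
    also have "\<dots> = L * mode_majorant s a 3 r (r / \<rho>) * norm (x - y)"
    proof -
      have "2 * (L * ((3 - s) / 2)) * (3 * (1 - s) / (3 - s) * r\<^sup>2) = L * (3 * (1 - s) * r\<^sup>2)"
        using s by simp
      thus ?thesis by (simp only: mode_majorant_def distrib_left)
    qed
    finally show "norm (h x - h y) \<le> (\<Lambda> + \<delta>) * mode_majorant s a 3 r (r / \<rho>) * norm (x - y)"
      by (simp add: L_def)
  next
    fix z :: complex
    assume z: "norm z < \<rho>"
    define r where "r = norm z"
    have r: "0 \<le> r" "r < \<rho>" "r \<le> 1" using z \<rho> by (auto simp: r_def)
    have "norm (h z) \<le> norm (A 1 * g z + C 1 * cnj (g z)) +
      (\<Sum>k=2..K. norm (A k * mode s k N z + C k * cnj (mode s k N z)))"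
      unfolding h_def by (rule norm_triangle_le[OF add_left_mono[OF norm_sum]])
    also have "\<dots> \<le> 2 * M 1 * ((1 - s) / (3 - s) * r\<^sup>2 * r) +
      (\<Sum>k=2..K. 2 * M k * (real k * r ^ (k - 1) * r))"
    proof (intro add_mono sum_mono norm_conjugate_pair_le AM CM)
      show "norm (g z) \<le> (1 - s) / (3 - s) * r\<^sup>2 * r"
        using norm_first_mode_minus_id_le[OF s, of z N] r by (simp add: g_def r_def)
      fix k assume k: "k \<in> {2..K}"
      then obtain j where j: "k = Suc j" by (cases k) auto
      have "norm (mode s k N z) \<le> 1 * r ^ k"
        using norm_mode_le[OF s, of k z N] r k by (simp add: r_def)
      also have "\<dots> \<le> real k * r ^ k" using k r by (intro mult_right_mono) auto
      finally show "norm (mode s k N z) \<le> real k * r ^ (k - 1) * r" by (simp add: j mult_ac)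
    qed auto
    also have "\<dots> = (2 * M 1 * ((1 - s) / (3 - s) * r\<^sup>2) +
      (\<Sum>k=2..K. 2 * M k * (real k * r ^ (k - 1)))) * r"
      by (simp add: sum_distrib_right distrib_right mult.assoc)
    also have "\<dots> \<le> (2 * (L * ((3 - s) / 2)) * ((1 - s) / (3 - s) * r\<^sup>2) +
      L * (a / (1 - s) * (2 / (1 - r / \<rho>) ^ 3 - 2))) * r"
      using s r by (intro mult_right_mono add_mono higher mult_left_mono M1) auto
    also have "\<dots> = L * mode_majorant s a 1 r (r / \<rho>) * r"
    proof -
      have "2 * (L * ((3 - s) / 2)) * ((1 - s) / (3 - s) * r\<^sup>2) = L * (1 * (1 - s) * r\<^sup>2)"
        using s by simp
      thus ?thesis by (simp only: mode_majorant_def distrib_left)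
    qed
    finally show "norm (h z) \<le> (\<Lambda> + \<delta>) * mode_majorant s a 1 (norm z) (norm z / \<rho>) * norm z"
      by (simp add: L_def r_def)
  qed
qed

lemma mode_majorant_tendsto:
  assumes "0 \<le> r" "r < 1" and "\<rho> \<longlonglongrightarrow> (1::real)"
  shows "(\<lambda>n. mode_majorant s a c r (r / \<rho> n)) \<longlonglongrightarrow> mode_majorant s a c r r"
proof -
  have "(\<lambda>n. c * (1 - s) * r\<^sup>2 + a / (1 - s) * (2 / (1 - r / \<rho> n) ^ 3 - 2))
     \<longlonglongrightarrow> c * (1 - s) * r\<^sup>2 + a / (1 - s) * (2 / (1 - r / 1) ^ 3 - 2)"
    using assms by (intro tendsto_intros) auto
  thus ?thesis by (simp add: mode_majorant_def)
qed

text \<open>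
Apply \<open>linear_approximation\<close> with radii tending to \<open>1\<close> and errors tending to \<open>0\<close>. The linear parts have
bounded coefficients, so they converge along a subsequence; the bound for the values at small \<open>|z|\<close> forces the
limit to be the derivative of \<open>f\<close> at \<open>0\<close>.
\<close>

lemma deviation_from_derivative:
  assumes s: "0 < s" "s < 1" and a: "1 - s / 2 \<le> a"
    and jet: "wirtinger_jet (ball 0 1) f p q l"
    and harm: "\<And>z. norm z < 1 \<Longrightarrow> alpha_op s f p q l z = 0"
    and bound: "\<And>z. norm z < 1 \<Longrightarrow> norm (f z) \<le> \<Lambda> * norm z"
    and \<Lambda>: "\<Lambda> \<ge> 0"
  defines "g \<equiv> \<lambda>z. f z - (p 0 * z + q 0 * cnj z)"
  shows "\<And>x y r. norm x \<le> r \<Longrightarrow> norm y \<le> r \<Longrightarrow> r < 1 \<Longrightarrow>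
       norm (g x - g y) \<le> \<Lambda> * mode_majorant s a 3 r r * norm (x - y)"
    and "\<And>z. norm z < 1 \<Longrightarrow>
       norm (g z) \<le> \<Lambda> * mode_majorant s a 1 (norm z) (norm z) * norm z"
proof -
  define \<rho> where "\<rho> n = 1 - 1 / (real n + 2)" for n
  define \<delta> where "\<delta> n = 1 / (real n + 1)" for n
  have \<rho>: "0 < \<rho> n" "\<rho> n < 1" and \<delta>: "\<delta> n > 0" for n
    by (auto simp: \<rho>_def \<delta>_def field_simps)
  have \<delta>1: "\<delta> n \<le> 1" for n by (simp add: \<delta>_def)
  have \<delta>lim: "\<delta> \<longlonglongrightarrow> 0"
    unfolding \<delta>_def[abs_def] using LIMSEQ_inverse_real_of_nat by (simp add: inverse_eq_divide add.commute)
  have "(\<lambda>n. 1 / (real n + 2)) \<longlonglongrightarrow> 0"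
    using LIMSEQ_Suc[OF LIMSEQ_inverse_real_of_nat] by (simp add: inverse_eq_divide add.commute)
  hence "(\<lambda>n. 1 - 1 / (real n + 2)) \<longlonglongrightarrow> 1 - 0" by (intro tendsto_intros)
  hence \<rho>lim: "\<rho> \<longlonglongrightarrow> 1" by (simp add: \<rho>_def[abs_def])
  define P where "P n A C h \<longleftrightarrow>
      (\<forall>z. norm z \<le> \<rho> n \<longrightarrow> norm (f z - (A * z + C * cnj z + h z)) \<le> \<delta> n) \<and>
      norm A \<le> (\<Lambda> + \<delta> n) * ((3 - s) / 2) \<and> norm C \<le> (\<Lambda> + \<delta> n) * ((3 - s) / 2) \<and>
      (\<forall>x y r. norm x \<le> r \<longrightarrow> norm y \<le> r \<longrightarrow> r < \<rho> n \<longrightarrow>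
        norm (h x - h y) \<le> (\<Lambda> + \<delta> n) * mode_majorant s a 3 r (r / \<rho> n) * norm (x - y)) \<and>
      (\<forall>z. norm z < \<rho> n \<longrightarrow>
        norm (h z) \<le> (\<Lambda> + \<delta> n) * mode_majorant s a 1 (norm z) (norm z / \<rho> n) * norm z)"
    for n A C h
  have "\<exists>A C h. P n A C h" for n
  proof (rule linear_approximation[OF s a jet harm bound \<rho>[of n] \<delta>[of n] \<Lambda>], assumption, assumption)
    fix A C h
    assume "\<And>z. norm z \<le> \<rho> n \<Longrightarrow> norm (f z - (A * z + C * cnj z + h z)) \<le> \<delta> n"
    "norm A \<le> (\<Lambda> + \<delta> n) * ((3 - s) / 2)" "norm C \<le> (\<Lambda> + \<delta> n) * ((3 - s) / 2)"
    "\<And>x y r. norm x \<le> r \<Longrightarrow> norm y \<le> r \<Longrightarrow> r < \<rho> n \<Longrightarrow>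
       norm (h x - h y) \<le> (\<Lambda> + \<delta> n) * mode_majorant s a 3 r (r / \<rho> n) * norm (x - y)"
    "\<And>z. norm z < \<rho> n \<Longrightarrow>
       norm (h z) \<le> (\<Lambda> + \<delta> n) * mode_majorant s a 1 (norm z) (norm z / \<rho> n) * norm z"
    hence "P n A C h" unfolding P_def by blast
    thus ?thesis by blast
  qed
  then obtain A C h where P: "\<And>n. P n (A n) (C n) (h n)" by metis
  define M where "M = (\<Lambda> + 1) * 2"
  have "(\<Lambda> + \<delta> n) * ((3 - s) / 2) \<le> M" for n
    unfolding M_def using \<Lambda> \<delta>1[of n] s by (intro mult_mono) auto
  hence AC: "norm (A n) \<le> M" "norm (C n) \<le> M" for n
    using P[of n] unfolding P_def by (meson order_trans)+
  have "norm (A n, C n) \<le> M + M" for n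
    using AC[of n] norm_Pair_le[of "A n" "C n"] by linarith
  hence "\<forall>n. (A n, C n) \<in> cball 0 (M + M)" by simp
  from this obtain A0C0 \<sigma> where \<sigma>: "strict_mono \<sigma>" and lim: "((\<lambda>n. (A n, C n)) \<circ> \<sigma>) \<longlonglongrightarrow> A0C0"
    by (rule seq_compactE[OF compact_imp_seq_compact[OF compact_cball]]) (rule that)
  define A0 C0 where "A0 = fst A0C0" and "C0 = snd A0C0"
  have Alim: "(\<lambda>n. A (\<sigma> n)) \<longlonglongrightarrow> A0" and Clim: "(\<lambda>n. C (\<sigma> n)) \<longlonglongrightarrow> C0"
    using tendsto_fst[OF lim] tendsto_snd[OF lim] by (simp_all add: A0_def C0_def o_def)
  have \<delta>s: "(\<lambda>n. \<delta> (\<sigma> n)) \<longlonglongrightarrow> 0" and \<rho>s: "(\<lambda>n. \<rho> (\<sigma> n)) \<longlonglongrightarrow> 1"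
    using LIMSEQ_subseq_LIMSEQ[OF \<delta>lim \<sigma>] LIMSEQ_subseq_LIMSEQ[OF \<rho>lim \<sigma>] by (simp_all add: o_def)
  define g0 where "g0 z = f z - (A0 * z + C0 * cnj z)" for z
  have ev: "\<forall>\<^sub>F n in sequentially. r < \<rho> (\<sigma> n)" if "r < 1" for r
    by (rule order_tendstoD(1)[OF \<rho>s that])
  have hlim: "(\<lambda>n. h (\<sigma> n) z) \<longlonglongrightarrow> g0 z" if z: "norm z < 1" for z
  proof -
    have "(\<lambda>n. f z - (A (\<sigma> n) * z + C (\<sigma> n) * cnj z + h (\<sigma> n) z)) \<longlonglongrightarrow> 0"
    proof (rule tendsto_0_le[OF \<delta>s, of _ 1])
      show "\<forall>\<^sub>F n in sequentially. norm (f z - (A (\<sigma> n) * z + C (\<sigma> n) * cnj z + h (\<sigma> n) z)) \<le> norm (\<delta> (\<sigma> n)) * 1"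
        using ev[OF z]
      proof eventually_elim
        case (elim n)
        have "norm (f z - (A (\<sigma> n) * z + C (\<sigma> n) * cnj z + h (\<sigma> n) z)) \<le> \<delta> (\<sigma> n)"
          using P[of "\<sigma> n"] elim unfolding P_def by (meson less_imp_le)
        thus ?case by simp
      qed
    qed
    hence "(\<lambda>n. f z - (A (\<sigma> n) * z + C (\<sigma> n) * cnj z) - (f z - (A (\<sigma> n) * z + C (\<sigma> n) * cnj z + h (\<sigma> n) z)))
       \<longlonglongrightarrow> f z - (A0 * z + C0 * cnj z) - 0"
      by (intro tendsto_intros Alim Clim)
    thus ?thesis by (simp add: g0_def)
  qed
  have lip: "norm (g0 x - g0 y) \<le> \<Lambda> * mode_majorant s a 3 r r * norm (x - y)"
    if xyr: "norm x \<le> r" "norm y \<le> r" "r < 1" for x y r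
  proof (rule tendsto_le)
    have r: "0 \<le> r" using order_trans[OF norm_ge_zero xyr(1)] .
    show "(\<lambda>n. (\<Lambda> + \<delta> (\<sigma> n)) * mode_majorant s a 3 r (r / \<rho> (\<sigma> n)) * norm (x - y))
        \<longlonglongrightarrow> \<Lambda> * mode_majorant s a 3 r r * norm (x - y)"
      using tendsto_mult_right[OF tendsto_mult[OF tendsto_add[OF tendsto_const \<delta>s]
        mode_majorant_tendsto[OF r xyr(3) \<rho>s]], of \<Lambda>] by simp
    show "(\<lambda>n. norm (h (\<sigma> n) x - h (\<sigma> n) y)) \<longlonglongrightarrow> norm (g0 x - g0 y)"
      using xyr by (intro tendsto_intros hlim) auto
    show "\<forall>\<^sub>F n in sequentially. norm (h (\<sigma> n) x - h (\<sigma> n) y)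
        \<le> (\<Lambda> + \<delta> (\<sigma> n)) * mode_majorant s a 3 r (r / \<rho> (\<sigma> n)) * norm (x - y)"
      using ev[OF xyr(3)]
    proof eventually_elim
      case (elim n)
      thus ?case using P[of "\<sigma> n"] xyr unfolding P_def by blast
    qed
  qed simp
  have val: "norm (g0 z) \<le> \<Lambda> * mode_majorant s a 1 (norm z) (norm z) * norm z"
    if z: "norm z < 1" for z
  proof (rule tendsto_le)
    show "(\<lambda>n. (\<Lambda> + \<delta> (\<sigma> n)) * mode_majorant s a 1 (norm z) (norm z / \<rho> (\<sigma> n)) * norm z)
        \<longlonglongrightarrow> \<Lambda> * mode_majorant s a 1 (norm z) (norm z) * norm z"
      using tendsto_mult_right[OF tendsto_mult[OF tendsto_add[OF tendsto_const \<delta>s]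
        mode_majorant_tendsto[OF norm_ge_zero z \<rho>s]], of \<Lambda>] by simp
    show "(\<lambda>n. norm (h (\<sigma> n) z)) \<longlonglongrightarrow> norm (g0 z)"
      using z by (intro tendsto_intros hlim) auto
    show "\<forall>\<^sub>F n in sequentially. norm (h (\<sigma> n) z)
        \<le> (\<Lambda> + \<delta> (\<sigma> n)) * mode_majorant s a 1 (norm z) (norm z / \<rho> (\<sigma> n)) * norm z"
      using ev[OF z]
    proof eventually_elim
      case (elim n)
      thus ?case using P[of "\<sigma> n"] unfolding P_def by blast
    qed
  qed simp
  have f0: "f 0 = 0" using bound[of 0] by simp
  have "(g0 has_derivative (\<lambda>w. 0)) (at 0)"
    unfolding has_derivative_at_alt
  proof (intro conjI allI impI)
    fix e :: real assume e: "e > 0"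
    have "isCont (\<lambda>r. \<Lambda> * mode_majorant s a 1 r r) 0"
      unfolding mode_majorant_def by (intro continuous_intros) auto
    then obtain d where d: "d > 0" "\<And>r. \<bar>r\<bar> < d \<Longrightarrow> \<bar>\<Lambda> * mode_majorant s a 1 r r\<bar> < e"
      using e unfolding continuous_at_eps_delta by (force simp: mode_majorant_def)
    show "\<exists>d>0. \<forall>y. norm (y - 0) < d \<longrightarrow> norm (g0 y - g0 0 - 0) \<le> e * norm (y - 0)"
    proof (intro exI[of _ "min d 1"] conjI allI impI)
      fix y :: complex assume y: "norm (y - 0) < min d 1"
      have "norm (g0 y) \<le> \<Lambda> * mode_majorant s a 1 (norm y) (norm y) * norm y"
        using val y by simp
      also have "\<dots> \<le> e * norm y"
        using d(2)[of "norm y"] y by (intro mult_right_mono) auto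
      finally show "norm (g0 y - g0 0 - 0) \<le> e * norm (y - 0)" by (simp add: g0_def f0)
    qed (use d in auto)
  qed simp
  moreover have "((\<lambda>z. A0 * z + C0 * cnj z) has_derivative (\<lambda>w. A0 * w + C0 * cnj w)) (at 0)"
    by (auto intro!: derivative_eq_intros)
  ultimately have "((\<lambda>z. g0 z + (A0 * z + C0 * cnj z)) has_derivative (\<lambda>w. 0 + (A0 * w + C0 * cnj w))) (at 0)"
    by (rule has_derivative_add)
  hence "(f has_derivative (\<lambda>w. A0 * w + C0 * cnj w)) (at 0)" by (simp add: g0_def)
  moreover have "(f has_derivative (\<lambda>w. p 0 * w + q 0 * cnj w)) (at 0)"
    using jet unfolding wirtinger_jet_def by simp
  ultimately have eq: "(\<lambda>w. A0 * w + C0 * cnj w) = (\<lambda>w. p 0 * w + q 0 * cnj w)"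
    by (rule has_derivative_unique)
  have gg: "g = g0"
    unfolding g_def using fun_cong[OF eq] by (simp add: g0_def fun_eq_iff)
  show "norm (g x - g y) \<le> \<Lambda> * mode_majorant s a 3 r r * norm (x - y)"
    if "norm x \<le> r" "norm y \<le> r" "r < 1" for x y r
    using lip[OF that] gg by simp
  show "norm (g z) \<le> \<Lambda> * mode_majorant s a 1 (norm z) (norm z) * norm z" if "norm z < 1" for z
    using val[OF that] gg by simp
qed

section \<open>Injectivity and schlicht discs\<close>

text \<open>
If \<open>f x = f y\<close>, then \<open>L (x - y)\<close> is an increment of \<open>f - L\<close>, too small compared with the lower bound
for \<open>L\<close>.
\<close>

lemma injective_of_deviation:
  fixes f L :: "complex \<Rightarrow> complex" and \<phi> :: "real \<Rightarrow> real"
  assumes L: "linear L" "\<And>w. \<beta> * norm w \<le> norm (L w)"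
    and lip: "\<And>x y r. norm x \<le> r \<Longrightarrow> norm y \<le> r \<Longrightarrow> r < \<rho> \<Longrightarrow>
        norm ((f x - L x) - (f y - L y)) \<le> \<phi> r * norm (x - y)"
    and \<phi>: "\<And>r. 0 \<le> r \<Longrightarrow> r < \<rho> \<Longrightarrow> \<phi> r < \<beta>"
  shows "inj_on f (ball 0 \<rho>)"
proof (rule inj_onI, rule ccontr)
  fix x y assume xy: "x \<in> ball 0 \<rho>" "y \<in> ball 0 \<rho>" "f x = f y" "x \<noteq> y"
  define r where "r = max (norm x) (norm y)"
  have r: "norm x \<le> r" "norm y \<le> r" "0 \<le> r" "r < \<rho>" using xy by (auto simp: r_def le_max_iff_disj)
  have "\<beta> * norm (x - y) \<le> norm (L (x - y))" by (rule L)
  also have "L (x - y) = - ((f x - L x) - (f y - L y))"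
    using xy(3) by (simp add: linear_diff[OF L(1)])
  also have "norm \<dots> \<le> \<phi> r * norm (x - y)" unfolding norm_minus_cancel by (rule lip[OF r(1,2,4)])
  also have "\<dots> < \<beta> * norm (x - y)" using \<phi>[OF r(3,4)] xy(4) by (intro mult_strict_right_mono) auto
  finally show False by simp
qed

text \<open>
The disc of radius \<open>R\<close> is covered by the open image of the open ball and the open complement of the image of the
closed ball, because \<open>f\<close> maps the boundary circle outside of it. The image contains \<open>0\<close>, so by
connectedness it contains the disc; the preimage of the disc is the required subdomain.
\<close>

lemma schlicht_disc_of_boundary_bound:
  assumes \<rho>: "\<rho> > 0" and cont: "continuous_on (cball 0 \<rho>) f" and inj: "inj_on f (ball 0 \<rho>)"
    and f0: "f 0 = 0" and R: "R > 0" and bd: "\<And>z. norm z = \<rho> \<Longrightarrow> R \<le> norm (f z)"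
  shows "contains_schlicht_disc f (ball 0 \<rho>) R"
proof -
  define V where "V = f ` ball 0 \<rho>"
  have contb: "continuous_on (ball 0 \<rho>) f" by (rule continuous_on_subset[OF cont]) auto
  have V: "open V" unfolding V_def by (rule invariance_of_domain[OF contb open_ball inj])
  have "compact (f ` cball 0 \<rho>)" by (rule compact_continuous_image[OF cont compact_cball])
  hence B: "open (- (f ` cball 0 \<rho>))" by (simp add: open_Compl compact_imp_closed)
  have cover: "ball 0 R \<subseteq> V \<union> - (f ` cball 0 \<rho>)"
  proof
    fix w :: complex assume w: "w \<in> ball 0 R"
    show "w \<in> V \<union> - (f ` cball 0 \<rho>)"
    proof (cases "w \<in> f ` cball 0 \<rho>")
      case True
      then obtain z where z: "norm z \<le> \<rho>" "w = f z" by auto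
      have "norm z \<noteq> \<rho>" using bd[of z] w z by auto
      thus ?thesis using z by (auto simp: V_def)
    qed simp
  qed
  have disj: "V \<inter> - (f ` cball 0 \<rho>) \<inter> ball 0 R = {}" by (auto simp: V_def)
  have "0 \<in> V" unfolding V_def using \<rho> f0 by (metis centre_in_ball image_eqI)
  hence "V \<inter> ball 0 R \<noteq> {}" using R by auto
  hence "- (f ` cball 0 \<rho>) \<inter> ball 0 R = {}"
    using connectedD[OF connected_ball V B disj cover] by blast
  hence sub: "ball 0 R \<subseteq> V" using cover by blast
  obtain g where g: "homeomorphism (ball 0 \<rho>) V f g"
    using invariance_of_domain_homeomorphism[OF open_ball contb order_refl inj] unfolding V_def by metis
  have gf: "g (f z) = z" if "z \<in> ball 0 \<rho>" for z
    by (rule homeomorphism_apply1[OF g that])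
  have fg: "f (g w) = w" "g w \<in> ball 0 \<rho>" if "w \<in> ball 0 R" for w
    using homeomorphism_apply2[OF g, of w] homeomorphism_image2[OF g] that sub by blast+
  define U where "U = g ` ball 0 R"
  have Ueq: "U = ball 0 \<rho> \<inter> f -` ball 0 R"
  proof (intro equalityI subsetI)
    fix z assume "z \<in> U"
    thus "z \<in> ball 0 \<rho> \<inter> f -` ball 0 R" using fg by (force simp: U_def)
  next
    fix z assume z: "z \<in> ball 0 \<rho> \<inter> f -` ball 0 R"
    hence "z = g (f z)" "f z \<in> ball 0 R" using gf by simp_all
    thus "z \<in> U" unfolding U_def by (rule image_eqI)
  qed
  have "open U" unfolding Ueq by (rule continuous_open_preimage[OF contb open_ball open_ball])
  moreover have "connected U" unfolding U_def
    by (rule connected_continuous_image[OF continuous_on_subset[OF homeomorphism_cont2[OF g] sub] connected_ball])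
  moreover have "f ` U = ball 0 R"
  proof -
    have "f ` U = (\<lambda>w. f (g w)) ` ball 0 R" unfolding U_def by (rule image_image)
    also have "\<dots> = (\<lambda>w. w) ` ball 0 R" by (rule image_cong[OF refl fg(1)])
    finally show ?thesis by simp
  qed
  moreover have "inj_on f U" by (rule inj_on_subset[OF inj]) (simp add: Ueq)
  moreover have "U \<subseteq> ball 0 \<rho>" by (simp add: Ueq)
  ultimately show ?thesis unfolding contains_schlicht_disc_def using R by blast
qed

section \<open>The majorant of the theorem\<close>

text \<open>
For \<open>c = 1\<close> and \<open>c = 1 / 3\<close> these are the two large brackets of the theorem, with their factor
\<open>2 / (2 - \<alpha>) = 1 / (1 - s)\<close>.
\<close>

definition landau_majorant :: "real \<Rightarrow> real \<Rightarrow> real \<Rightarrow> real \<Rightarrow> real" where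
  "landau_majorant s a c r = (2 * (1 - s) * (c * r\<^sup>2 / (1 - r)) + 2 * a / (1 - r) ^ 3 - 2 * a
     + (2 * a - 1) * (c * r\<^sup>2 / (1 - r\<^sup>2))) / (1 - s)"

text \<open>
The cubic terms are identical. With \<open>t = c r\<^sup>2\<close>, the first mode contributes \<open>3 (1 - s) t\<close>, which is at most \<open>3 t\<close>;
of this, \<open>2 t\<close> is absorbed by the first term of the majorant, and \<open>t\<close> by the last one because
\<open>2 a - 1 \<ge> 1 - s\<close>.
\<close>

lemma mode_majorant_le:
  assumes s: "0 < s" "s < 1" and a: "1 - s / 2 \<le> a" and r: "0 \<le> r" "r < 1" and c: "c \<ge> 0"
  shows "mode_majorant s a (3 * c) r r \<le> landau_majorant s a c r"
proof -
  have r2: "r\<^sup>2 < 1" using r by (simp add: abs_square_less_1)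
  define t where "t = c * r\<^sup>2"
  have t: "t \<ge> 0" using c by (simp add: t_def)
  have t1: "t \<le> t / (1 - r)" "t \<le> t / (1 - r\<^sup>2)"
    using t r r2 mult_left_mono[of "1 - r" 1 t] mult_left_mono[of "1 - r\<^sup>2" 1 t] by (simp_all add: pos_le_divide_eq)
  have "(3 * (1 - s)) * t * (1 - s) \<le> 3 * t * (1 - s)"
    using s t by (intro mult_right_mono) auto
  also have "\<dots> = 2 * (1 - s) * t + (1 - s) * t" by (simp add: algebra_simps)
  also have "\<dots> \<le> 2 * (1 - s) * (t / (1 - r)) + (2 * a - 1) * (t / (1 - r\<^sup>2))"
    using s a t t1 by (intro add_mono mult_left_mono mult_mono) auto
  finally have "(3 * (1 - s)) * t * (1 - s) / (1 - s) \<le>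
      (2 * (1 - s) * (t / (1 - r)) + (2 * a - 1) * (t / (1 - r\<^sup>2))) / (1 - s)"
    using s by (intro divide_right_mono) auto
  hence "3 * c * (1 - s) * r\<^sup>2 \<le> (2 * (1 - s) * (t / (1 - r)) + (2 * a - 1) * (t / (1 - r\<^sup>2))) / (1 - s)"
    using s by (simp add: t_def mult_ac)
  moreover have "landau_majorant s a c r = (2 * (1 - s) * (t / (1 - r)) + (2 * a - 1) * (t / (1 - r\<^sup>2))) / (1 - s)
      + a / (1 - s) * (2 / (1 - r) ^ 3 - 2)"
  proof -
    have "a / (1 - s) * (2 / (1 - r) ^ 3 - 2) = (2 * a / (1 - r) ^ 3 - 2 * a) / (1 - s)"
      by (simp add: right_diff_distrib diff_divide_distrib mult_ac)
    thus ?thesis unfolding landau_majorant_def t_def by (simp only: add_divide_distrib[symmetric]) simp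
  qed
  ultimately show ?thesis unfolding mode_majorant_def by (simp only: add_mono order_refl)
qed

lemma landau_majorant_strict_mono:
  assumes s: "0 < s" "s < 1" and a: "1 - s / 2 \<le> a" and r: "0 \<le> r" "r < u" "u < 1" and c: "c \<ge> 0"
  shows "landau_majorant s a c r < landau_majorant s a c u"
proof -
  have sq: "r\<^sup>2 \<le> u\<^sup>2" "u\<^sup>2 < 1" using r by (auto intro!: power_mono simp: abs_square_less_1)
  have "(1 - u) ^ 3 < (1 - r) ^ 3" using r by (intro power_strict_mono) auto
  hence "2 * a / (1 - r) ^ 3 < 2 * a / (1 - u) ^ 3"
    using s a r by (intro divide_strict_left_mono) auto
  moreover have "2 * (1 - s) * (c * r\<^sup>2 / (1 - r)) \<le> 2 * (1 - s) * (c * u\<^sup>2 / (1 - u))"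
    using s r c sq by (intro mult_left_mono frac_le) auto
  moreover have "(2 * a - 1) * (c * r\<^sup>2 / (1 - r\<^sup>2)) \<le> (2 * a - 1) * (c * u\<^sup>2 / (1 - u\<^sup>2))"
    using s r c sq a by (intro mult_left_mono frac_le) auto
  ultimately show ?thesis
    unfolding landau_majorant_def using s by (intro divide_strict_right_mono) auto
qed

text \<open>
The majorant is continuous, vanishes at \<open>0\<close>, and is unbounded near \<open>1\<close> because of its cubic term.
\<close>

lemma landau_majorant_surj:
  assumes s: "0 < s" "s < 1" and a: "1 - s / 2 \<le> a" and y: "y > 0"
  shows "\<exists>\<rho>. 0 < \<rho> \<and> \<rho> < 1 \<and> landau_majorant s a 1 \<rho> = y"
proof -
  define X where "X = y * (1 - s) / (2 * a)"
  have a0: "a > 0" using s a by simp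
  have X: "X > 0" using s a0 y by (simp add: X_def)
  \<comment> \<open>Here \<open>1 / (1 - u) = 1 + X\<close>, and already the estimate \<open>(1 + X) ^ 3 - 1 \<ge> X\<close> lifts the cubic term to \<open>y\<close>.\<close>
  define u where "u = 1 - 1 / (1 + X)"
  have u: "0 < u" "u < 1" "1 - u = 1 / (1 + X)" using X by (auto simp: u_def field_simps)
  have u2: "u\<^sup>2 < 1" using u by (simp add: abs_square_less_1)
  have "1 + X \<le> (1 + X) ^ 3" using X by (intro self_le_power) auto
  hence "2 * a * X \<le> 2 * a * ((1 + X) ^ 3 - 1)" using a0 by (intro mult_left_mono) auto
  also have "(1 + X) ^ 3 = 1 / (1 - u) ^ 3" unfolding u(3) by (simp add: power_divide)
  also have "2 * a * (1 / (1 - u) ^ 3 - 1) = 0 + 2 * a / (1 - u) ^ 3 - 2 * a + 0" by (simp add: algebra_simps)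
  also have "\<dots> \<le> 2 * (1 - s) * (1 * u\<^sup>2 / (1 - u)) + 2 * a / (1 - u) ^ 3 - 2 * a
     + (2 * a - 1) * (1 * u\<^sup>2 / (1 - u\<^sup>2))"
    using s a u(1,2) u2
    by (intro add_mono diff_right_mono mult_nonneg_nonneg divide_nonneg_nonneg) auto
  finally have "2 * a * X / (1 - s) \<le> landau_majorant s a 1 u"
    unfolding landau_majorant_def using s by (intro divide_right_mono) auto
  moreover have "2 * a * X / (1 - s) = y" using s a0 by (simp add: X_def)
  ultimately have hi: "y \<le> landau_majorant s a 1 u" by simp
  have "continuous_on {0..u} (landau_majorant s a 1)"
  proof -
    have "1 - r\<^sup>2 \<noteq> 0" if "r \<in> {0..u}" for r
      using that u abs_square_less_1[of r] by auto
    thus ?thesis unfolding landau_majorant_def[abs_def] using u s by (intro continuous_intros) auto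
  qed
  moreover have lo: "landau_majorant s a 1 0 = 0" by (simp add: landau_majorant_def)
  ultimately obtain \<rho> where \<rho>: "0 \<le> \<rho>" "\<rho> \<le> u" "landau_majorant s a 1 \<rho> = y"
    using IVT'[of "landau_majorant s a 1" 0 y u] hi u y by auto
  moreover have "\<rho> \<noteq> 0" using \<rho> lo y by auto
  ultimately show ?thesis using u by (intro exI[of _ \<rho>]) auto
qed

section \<open>Univalence and the schlicht disc\<close>

theorem theorem3p1:
  fixes \<alpha> \<beta> \<Lambda> a :: real and f :: "complex \<Rightarrow> complex" and E B :: "real \<Rightarrow> real"
  assumes "0 < \<alpha>" and "\<alpha> < 2"
    and "0 < \<beta>" and "0 < \<Lambda>"
    and "C2_on (ball 0 1) f"
    and "\<forall>z\<in>ball 0 1. T_op \<alpha> f z = 0"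
    and "f 0 = 0"
    and "min_dilation f 0 \<ge> \<beta>"
    and "\<forall>z\<in>ball 0 1. max_dilation f z \<le> \<Lambda>"
  defines "a \<equiv> Gamma (\<alpha> / 2 + 1) / Gamma (1 + \<alpha>)"
  defines "E \<equiv> (\<lambda>\<rho>. \<beta> - 2 * \<Lambda> / (2 - \<alpha>) *
      ((2 - \<alpha>) * (\<rho>\<^sup>2 / (1 - \<rho>)) + 2 * a / (1 - \<rho>) ^ 3 - 2 * a
        + (2 * a - 1) * (\<rho>\<^sup>2 / (1 - \<rho>\<^sup>2))))"
  defines "B \<equiv> (\<lambda>\<rho>. \<rho> * (\<beta> - 2 * \<Lambda> / (2 - \<alpha>) *
      ((2 - \<alpha>) / (1 - \<rho>) * (\<rho>\<^sup>2 / 3) + 2 * a / (1 - \<rho>) ^ 3 - 2 * a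
        + (2 * a - 1) / (1 - \<rho>\<^sup>2) * (\<rho>\<^sup>2 / 3))))"
  shows "(\<exists>\<rho>\<^sub>0. 0 < \<rho>\<^sub>0 \<and> \<rho>\<^sub>0 < 1 \<and> E \<rho>\<^sub>0 = 0) \<and>
    (\<forall>\<rho>\<^sub>0. 0 < \<rho>\<^sub>0 \<and> \<rho>\<^sub>0 < 1 \<and> E \<rho>\<^sub>0 = 0 \<longrightarrow>
       inj_on f (ball 0 \<rho>\<^sub>0) \<and>
       (\<exists>R\<^sub>0. R\<^sub>0 \<ge> B \<rho>\<^sub>0 \<and> contains_schlicht_disc f (ball 0 \<rho>\<^sub>0) R\<^sub>0))"
proof -
  define s where "s = \<alpha> / 2"
  have s: "0 < s" "s < 1" and \<alpha>: "\<alpha> = 2 * s" using assms(1,2) by (auto simp: s_def)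
  have a: "1 - s / 2 \<le> a"
    using Gamma_ratio_ge[OF s] by (simp add: a_def \<alpha>)
  have frac: "2 * \<Lambda> / (2 - \<alpha>) * x = \<Lambda> * (x / (1 - s))" for x
  proof -
    have "2 * \<Lambda> / (2 - \<alpha>) = 2 * \<Lambda> / (2 * (1 - s))" by (simp add: \<alpha>)
    also have "\<dots> = \<Lambda> / (1 - s)" by (rule mult_divide_mult_cancel_left) simp
    finally show ?thesis by simp
  qed
  have E: "E \<rho> = \<beta> - \<Lambda> * landau_majorant s a 1 \<rho>" for \<rho>
    unfolding E_def frac landau_majorant_def by (simp add: \<alpha>)
  have B: "B \<rho> = \<rho> * (\<beta> - \<Lambda> * landau_majorant s a (1 / 3) \<rho>)" for \<rho>
    unfolding B_def frac landau_majorant_def by (simp add: \<alpha> mult.commute)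
  define p q where "p = wirtinger f" and "q = wirtinger_bar f"
  define l where "l = (\<lambda>z. laplacian f z / 4)"
  have jet: "wirtinger_jet (ball 0 1) f p q l"
    unfolding p_def q_def l_def by (rule wirtinger_jet_of_C2[OF open_ball assms(5)])
  have harm: "alpha_op s f p q l z = 0" if "norm z < 1" for z
    unfolding s_def p_def q_def l_def using alpha_op_eq_zero_of_T_op[of \<alpha> f z] assms(6) that by simp
  have bound: "norm (f z) \<le> \<Lambda> * norm z" if "norm z < 1" for z
    using wirtinger_jet_lipschitz[OF jet convex_ball, of \<Lambda> z 0] assms(7,9) that
    by (simp add: max_dilation_def p_def q_def)
  define L where "L = (\<lambda>w. p 0 * w + q 0 * cnj w)"
  have linL: "linear L" unfolding L_def by (rule linearI) (simp_all add: algebra_simps scaleR_conv_of_real)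
  have Lge: "\<beta> * norm w \<le> norm (L w)" for w
  proof -
    have "\<beta> * norm w \<le> \<bar>norm (p 0) - norm (q 0)\<bar> * norm w"
      using assms(8) by (intro mult_right_mono) (auto simp: min_dilation_def p_def q_def)
    also have "\<dots> = \<bar>norm (p 0 * w) - norm (- (q 0 * cnj w))\<bar>"
      by (simp add: norm_mult abs_mult left_diff_distrib[symmetric])
    also have "\<dots> \<le> norm (p 0 * w - - (q 0 * cnj w))" by (rule norm_triangle_ineq3)
    finally show ?thesis by (simp add: L_def)
  qed
  note dev = deviation_from_derivative[OF s a jet harm bound less_imp_le[OF assms(4)], folded L_def]
  have lip: "norm ((f x - L x) - (f y - L y)) \<le> \<Lambda> * landau_majorant s a 1 r * norm (x - y)"
    if "norm x \<le> r" "norm y \<le> r" "r < 1" for x y r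
  proof -
    have r: "0 \<le> r" using order_trans[OF norm_ge_zero that(1)] .
    have "norm ((f x - L x) - (f y - L y)) \<le> \<Lambda> * mode_majorant s a 3 r r * norm (x - y)"
      using dev(1)[of x r y] that unfolding L_def by simp
    also have "\<dots> \<le> \<Lambda> * landau_majorant s a 1 r * norm (x - y)"
      using mode_majorant_le[OF s a r that(3), of 1] assms(4) by (intro mult_right_mono mult_left_mono) auto
    finally show ?thesis .
  qed
  have val: "norm z * (\<beta> - \<Lambda> * landau_majorant s a (1 / 3) (norm z)) \<le> norm (f z)"
    if z: "norm z < 1" for z
  proof -
    have "norm (f z - L z) \<le> \<Lambda> * mode_majorant s a 1 (norm z) (norm z) * norm z"
      using dev(2)[of z] z unfolding L_def by simp
    also have "\<dots> \<le> \<Lambda> * landau_majorant s a (1 / 3) (norm z) * norm z"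
      using mode_majorant_le[OF s a norm_ge_zero z, of "1 / 3"] assms(4)
      by (intro mult_right_mono mult_left_mono) auto
    finally have "norm (f z - L z) \<le> \<Lambda> * landau_majorant s a (1 / 3) (norm z) * norm z" .
    moreover have "norm (L z) \<le> norm (f z) + norm (f z - L z)"
      using norm_triangle_sub[of "L z" "f z"] by (simp add: norm_minus_commute)
    ultimately show ?thesis using Lge[of z] by (simp add: algebra_simps)
  qed
  have contf: "continuous_on (ball 0 1) f" by (rule wirtinger_jet_imp_continuous_on[OF jet])
  show ?thesis
  proof (intro conjI allI impI)
    obtain \<rho> where \<rho>: "0 < \<rho>" "\<rho> < 1" "landau_majorant s a 1 \<rho> = \<beta> / \<Lambda>"
      using landau_majorant_surj[OF s a, of "\<beta> / \<Lambda>"] assms(3,4) by auto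
    thus "\<exists>\<rho>\<^sub>0. 0 < \<rho>\<^sub>0 \<and> \<rho>\<^sub>0 < 1 \<and> E \<rho>\<^sub>0 = 0"
      using assms(4) by (intro exI[of _ \<rho>]) (simp add: E)
  next
    fix \<rho> assume "0 < \<rho> \<and> \<rho> < 1 \<and> E \<rho> = 0"
    hence \<rho>: "0 < \<rho>" "\<rho> < 1" and \<beta>: "\<beta> = \<Lambda> * landau_majorant s a 1 \<rho>" by (auto simp: E)
    show inj: "inj_on f (ball 0 \<rho>)"
    proof (rule injective_of_deviation[OF linL Lge, where \<phi>="\<lambda>r. \<Lambda> * landau_majorant s a 1 r"])
      show "norm ((f x - L x) - (f y - L y)) \<le> \<Lambda> * landau_majorant s a 1 r * norm (x - y)"
        if "norm x \<le> r" "norm y \<le> r" "r < \<rho>" for x y r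
        using lip[OF that(1,2)] that(3) \<rho>(2) by simp
      show "\<Lambda> * landau_majorant s a 1 r < \<beta>" if "0 \<le> r" "r < \<rho>" for r
        unfolding \<beta> using landau_majorant_strict_mono[OF s a that \<rho>(2), of 1] assms(4) by simp
    qed
    have \<rho>2: "\<rho>\<^sup>2 < 1" using \<rho> by (simp add: abs_square_less_1)
    have "landau_majorant s a (1 / 3) \<rho> < landau_majorant s a 1 \<rho>"
    proof -
      have "1 / 3 * \<rho>\<^sup>2 / (1 - \<rho>) < 1 * \<rho>\<^sup>2 / (1 - \<rho>)"
        using \<rho> by (intro divide_strict_right_mono) auto
      hence "2 * (1 - s) * (1 / 3 * \<rho>\<^sup>2 / (1 - \<rho>)) < 2 * (1 - s) * (1 * \<rho>\<^sup>2 / (1 - \<rho>))"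
        using s by (intro mult_strict_left_mono) auto
      moreover have "(2 * a - 1) * (1 / 3 * \<rho>\<^sup>2 / (1 - \<rho>\<^sup>2)) \<le> (2 * a - 1) * (1 * \<rho>\<^sup>2 / (1 - \<rho>\<^sup>2))"
        using s a \<rho>2 by (intro mult_left_mono divide_right_mono) auto
      ultimately show ?thesis
        unfolding landau_majorant_def using s by (intro divide_strict_right_mono) auto
    qed
    hence Bpos: "B \<rho> > 0" unfolding B \<beta> using assms(4) \<rho> by simp
    have "contains_schlicht_disc f (ball 0 \<rho>) (B \<rho>)"
    proof (rule schlicht_disc_of_boundary_bound[OF \<rho>(1) _ inj assms(7) Bpos])
      show "continuous_on (cball 0 \<rho>) f"
        by (rule continuous_on_subset[OF contf]) (use \<rho> in auto)
      show "B \<rho> \<le> norm (f z)" if "norm z = \<rho>" for z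
        using val[of z] that \<rho> by (simp add: B)
    qed
    thus "\<exists>R\<^sub>0. R\<^sub>0 \<ge> B \<rho> \<and> contains_schlicht_disc f (ball 0 \<rho>) R\<^sub>0" by blast
  qed
qed

end
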